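(* Let $X$ be a compact complex manifold and let $W$ be a reduced divisor of $X$. If there exists a positive integer $m$ such that $mW$ is flat, then there exists a closed meromorphic $1$-form on $X$ with simple poles along the support of $W$ and holomorphic on the complement of $W$.
   Context: A reduced divisor is an analytic subvariety of pure codimension one. A divisor $D$ on $X$ is called flat if its associated holomorphic line bundle $[D]$ is flat, i.e. if, for some trivialization, the transition functions of $[D]$ can be taken to be constant functions. *)

theory Defs
  imports "HOL-Analysis.Analysis"
begin

section \<open>Holomorphic functions of several complex variables\<close>

text \<open>Meant for open \<open>S\<close>: the real Frechet derivative exists and is complex linear at
  every point of \<open>S\<close>.\<close>

definition holo_on :: "(complex ^ 'n::finite \<Rightarrow> complex) \<Rightarrow> (complex ^ 'n) set \<Rightarrow> bool" where
  "holo_on f S \<longleftrightarrow>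
     (\<forall>z\<in>S. \<exists>D. (f has_derivative D) (at z) \<and> (\<forall>a v. D (a *s v) = a * D v))"

text \<open>For \<open>f\<close> holomorphic near \<open>z\<close> the \<open>k\<close>-th entry of \<open>cgrad f z\<close> is the complex partial
  derivative of \<open>f\<close> in the \<open>k\<close>-th variable.\<close>

definition cgrad :: "(complex ^ 'n::finite \<Rightarrow> complex) \<Rightarrow> complex ^ 'n \<Rightarrow> complex ^ 'n" where
  "cgrad f z = (\<chi> k. frechet_derivative f (at z) (axis k 1))"


section \<open>Compact complex manifolds\<close>

text \<open>A chart is a domain together with a coordinate map; the values of the coordinate map
  outside the domain are irrelevant.\<close>

type_synonym ('a, 'n) chart = "'a set \<times> ('a \<Rightarrow> complex ^ 'n)"

definition coord_rep :: "('a, 'n::finite) chart \<Rightarrow> ('a \<Rightarrow> 'b) \<Rightarrow> complex ^ 'n \<Rightarrow> 'b" where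
  "coord_rep c f = f \<circ> inv_into (fst c) (snd c)"

text \<open>Dimension \<open>CARD('n)\<close>. Connectedness is not required, and
  second countability is automatic for compact spaces covered by charts.\<close>

definition compact_complex_manifold :: "'a topology \<Rightarrow> ('a, 'n::finite) chart set \<Rightarrow> bool" where
  "compact_complex_manifold X A \<longleftrightarrow>
     compact_space X \<and> Hausdorff_space X \<and>
     \<Union> (fst ` A) = topspace X \<and>
     (\<forall>(U, \<phi>)\<in>A. openin X U \<and> open (\<phi> ` U) \<and>
        homeomorphic_map (subtopology X U) (top_of_set (\<phi> ` U)) \<phi>) \<and>
     (\<forall>c\<in>A. \<forall>d\<in>A. \<forall>l.
        holo_on (\<lambda>z. coord_rep c (snd d) z $ l) (snd c ` (fst c \<inter> fst d)))"

definition holo_fun :: "('a, 'n::finite) chart set \<Rightarrow> 'a set \<Rightarrow> ('a \<Rightarrow> complex) \<Rightarrow> bool" where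
  "holo_fun A V f \<longleftrightarrow> (\<forall>c\<in>A. holo_on (coord_rep c f) (snd c ` (fst c \<inter> V)))"


section \<open>Reduced divisors\<close>

definition analytic_subset :: "'a topology \<Rightarrow> ('a, 'n::finite) chart set \<Rightarrow> 'a set \<Rightarrow> bool" where
  "analytic_subset X A W \<longleftrightarrow> W \<subseteq> topspace X \<and>
     (\<forall>p\<in>topspace X. \<exists>U F. openin X U \<and> p \<in> U \<and> finite F \<and> (\<forall>f\<in>F. holo_fun A U f) \<and>
        W \<inter> U = {x\<in>U. \<forall>f\<in>F. f x = 0})"

text \<open>Points near which \<open>W\<close> is a complex submanifold of codimension \<open>k\<close>.\<close>

definition regular_points ::
    "'a topology \<Rightarrow> ('a, 'n::finite) chart set \<Rightarrow> 'a set \<Rightarrow> nat \<Rightarrow> 'a set" where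
  "regular_points X A W k =
     {p\<in>W. \<exists>U (f :: nat \<Rightarrow> 'a \<Rightarrow> complex). openin X U \<and> p \<in> U \<and> (\<forall>i<k. holo_fun A U (f i)) \<and>
        W \<inter> U = {x\<in>U. \<forall>i<k. f i x = 0} \<and>
        (\<forall>c\<in>A. p \<in> fst c \<longrightarrow>
           (\<forall>a. (\<Sum>i<k. a i *s cgrad (coord_rep c (f i)) (snd c p)) = 0 \<longrightarrow> (\<forall>i<k. a i = 0)))}"

text \<open>The dimension of an analytic set at \<open>p\<close> is the largest dimension of a regular point
  arbitrarily close to \<open>p\<close>.\<close>

definition has_local_codim ::
    "'a topology \<Rightarrow> ('a, 'n::finite) chart set \<Rightarrow> 'a set \<Rightarrow> 'a \<Rightarrow> nat \<Rightarrow> bool" where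
  "has_local_codim X A W p k \<longleftrightarrow>
     p \<in> X closure_of regular_points X A W k \<and>
     (\<forall>j<k. p \<notin> X closure_of regular_points X A W j)"

definition reduced_divisor :: "'a topology \<Rightarrow> ('a, 'n::finite) chart set \<Rightarrow> 'a set \<Rightarrow> bool" where
  "reduced_divisor X A W \<longleftrightarrow>
     analytic_subset X A W \<and> (\<forall>p\<in>W. has_local_codim X A W p 1)"

text \<open>\<open>f\<close> cuts out \<open>W\<close> on \<open>U\<close> with multiplicity one: at each point its germ generates the
  ideal of germs vanishing on \<open>W\<close>.\<close>

definition local_defining_function ::
    "'a topology \<Rightarrow> ('a, 'n::finite) chart set \<Rightarrow> 'a set \<Rightarrow> 'a set \<Rightarrow> ('a \<Rightarrow> complex) \<Rightarrow> bool" where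
  "local_defining_function X A W U f \<longleftrightarrow>
     openin X U \<and> holo_fun A U f \<and> {x\<in>U. f x = 0} = W \<inter> U \<and>
     (\<forall>q\<in>U. \<forall>N h. openin X N \<and> q \<in> N \<and> N \<subseteq> U \<and> holo_fun A N h \<and> (\<forall>x\<in>W \<inter> N. h x = 0) \<longrightarrow>
        (\<exists>N' k. openin X N' \<and> q \<in> N' \<and> N' \<subseteq> N \<and> holo_fun A N' k \<and> (\<forall>x\<in>N'. h x = k x * f x)))"


section \<open>Line bundles and flat divisors\<close>

text \<open>A holomorphic line bundle is given by transition functions \<open>g i j\<close> on \<open>U i \<inter> U j\<close>; its
  sections are families \<open>s\<close> with \<open>s i = g i j * s j\<close>.\<close>

definition line_bundle ::
    "'a topology \<Rightarrow> ('a, 'n::finite) chart set \<Rightarrow> 'i set \<Rightarrow> ('i \<Rightarrow> 'a set) \<Rightarrow>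
     ('i \<Rightarrow> 'i \<Rightarrow> 'a \<Rightarrow> complex) \<Rightarrow> bool" where
  "line_bundle X A I U g \<longleftrightarrow>
     (\<forall>i\<in>I. openin X (U i)) \<and> (\<Union>i\<in>I. U i) = topspace X \<and>
     (\<forall>i\<in>I. \<forall>j\<in>I. holo_fun A (U i \<inter> U j) (g i j) \<and> (\<forall>x\<in>U i \<inter> U j. g i j x \<noteq> 0)) \<and>
     (\<forall>i\<in>I. \<forall>x\<in>U i. g i i x = 1) \<and>
     (\<forall>i\<in>I. \<forall>j\<in>I. \<forall>k\<in>I. \<forall>x\<in>U i \<inter> U j \<inter> U k. g i j x * g j k x = g i k x)"

definition local_frame ::
    "'a topology \<Rightarrow> ('a, 'n::finite) chart set \<Rightarrow> 'i set \<Rightarrow> ('i \<Rightarrow> 'a set) \<Rightarrow>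
     ('i \<Rightarrow> 'i \<Rightarrow> 'a \<Rightarrow> complex) \<Rightarrow> 'a set \<Rightarrow> ('i \<Rightarrow> 'a \<Rightarrow> complex) \<Rightarrow> bool" where
  "local_frame X A I U g V s \<longleftrightarrow>
     openin X V \<and>
     (\<forall>i\<in>I. holo_fun A (V \<inter> U i) (s i) \<and> (\<forall>x\<in>V \<inter> U i. s i x \<noteq> 0)) \<and>
     (\<forall>i\<in>I. \<forall>j\<in>I. \<forall>x\<in>V \<inter> U i \<inter> U j. s i x = g i j x * s j x)"

text \<open>A trivialization is a family \<open>T\<close> of local frames whose domains cover \<open>X\<close>; its transition
  functions are the quotients of two frames.\<close>

definition flat_line_bundle ::
    "'a topology \<Rightarrow> ('a, 'n::finite) chart set \<Rightarrow> 'i set \<Rightarrow> ('i \<Rightarrow> 'a set) \<Rightarrow>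
     ('i \<Rightarrow> 'i \<Rightarrow> 'a \<Rightarrow> complex) \<Rightarrow> bool" where
  "flat_line_bundle X A I U g \<longleftrightarrow>
     (\<exists>T. (\<forall>(V, s)\<in>T. local_frame X A I U g V s) \<and> \<Union> (fst ` T) = topspace X \<and>
        (\<forall>(V, s)\<in>T. \<forall>(V', s')\<in>T. \<exists>c. \<forall>i\<in>I. \<forall>x\<in>V \<inter> V' \<inter> U i. s i x = c * s' i x))"

text \<open>The line bundle \<open>[mW]\<close> of the divisor \<open>mW\<close>, for \<open>W\<close> a reduced divisor, has transition
  functions \<open>f\<^sup>m / f'\<^sup>m\<close>, where \<open>f\<close>, \<open>f'\<close> are local defining functions of \<open>W\<close>.
  The index set is the chosen system \<open>I\<close> of pairs (domain, defining function) itself.\<close>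

definition divisor_bundle ::
    "'a topology \<Rightarrow> ('a, 'n::finite) chart set \<Rightarrow> nat \<Rightarrow> 'a set \<Rightarrow>
     ('a set \<times> ('a \<Rightarrow> complex)) set \<Rightarrow>
     ('a set \<times> ('a \<Rightarrow> complex) \<Rightarrow> 'a set \<times> ('a \<Rightarrow> complex) \<Rightarrow> 'a \<Rightarrow> complex) \<Rightarrow> bool" where
  "divisor_bundle X A m W I g \<longleftrightarrow>
     (\<forall>(U, f)\<in>I. local_defining_function X A W U f) \<and>
     line_bundle X A I fst g \<and>
     (\<forall>i\<in>I. \<forall>j\<in>I. \<forall>x\<in>fst i \<inter> fst j. snd i x ^ m = g i j x * snd j x ^ m)"

text \<open>Up to isomorphism \<open>[mW]\<close> does not depend on the system of local defining functions.\<close>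

definition flat_multiple ::
    "'a topology \<Rightarrow> ('a, 'n::finite) chart set \<Rightarrow> nat \<Rightarrow> 'a set \<Rightarrow> bool" where
  "flat_multiple X A m W \<longleftrightarrow>
     (\<exists>I g. divisor_bundle X A m W I g \<and> flat_line_bundle X A I fst g)"


section \<open>Meromorphic one-forms\<close>

text \<open>A (1,0)-form is given by its coefficient vector in every chart of the atlas:
  in the chart \<open>c\<close> the form \<open>\<omega>\<close> is \<open>\<Sum>k. \<omega> c z $ k dz\<^sub>k\<close>.\<close>

type_synonym ('a, 'n) one_form = "('a, 'n) chart \<Rightarrow> complex ^ 'n \<Rightarrow> complex ^ 'n"

definition hol_one_form ::
    "('a, 'n::finite) chart set \<Rightarrow> 'a set \<Rightarrow> ('a, 'n) one_form \<Rightarrow> bool" where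
  "hol_one_form A V \<omega> \<longleftrightarrow>
     (\<forall>c\<in>A. \<forall>k. holo_on (\<lambda>z. \<omega> c z $ k) (snd c ` (fst c \<inter> V))) \<and>
     (\<forall>c\<in>A. \<forall>d\<in>A. \<forall>z\<in>snd c ` (fst c \<inter> fst d \<inter> V).
        \<omega> c z = (\<Sum>l\<in>UNIV. \<omega> d (coord_rep c (snd d) z) $ l *s
                    cgrad (\<lambda>w. coord_rep c (snd d) w $ l) z))"

definition closed_one_form ::
    "('a, 'n::finite) chart set \<Rightarrow> 'a set \<Rightarrow> ('a, 'n) one_form \<Rightarrow> bool" where
  "closed_one_form A V \<omega> \<longleftrightarrow>
     (\<forall>c\<in>A. \<forall>z\<in>snd c ` (fst c \<inter> V). \<forall>j k.
        cgrad (\<lambda>w. \<omega> c w $ k) z $ j = cgrad (\<lambda>w. \<omega> c w $ j) z $ k)"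

definition scale_form :: "('a \<Rightarrow> complex) \<Rightarrow> ('a, 'n::finite) one_form \<Rightarrow> ('a, 'n) one_form" where
  "scale_form f \<omega> = (\<lambda>c z. coord_rep c f z *s \<omega> c z)"

definition forms_agree ::
    "('a, 'n::finite) chart set \<Rightarrow> 'a set \<Rightarrow> ('a, 'n) one_form \<Rightarrow> ('a, 'n) one_form \<Rightarrow> bool" where
  "forms_agree A V \<eta> \<omega> \<longleftrightarrow> (\<forall>c\<in>A. \<forall>z\<in>snd c ` (fst c \<inter> V). \<eta> c z = \<omega> c z)"

text \<open>Locally \<open>\<omega> = \<eta> / g\<close> off the zeros of \<open>g\<close>; the values of \<open>\<omega>\<close> on its
  polar set carry no meaning.\<close>

definition meromorphic_one_form ::
    "'a topology \<Rightarrow> ('a, 'n::finite) chart set \<Rightarrow> ('a, 'n) one_form \<Rightarrow> bool" where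
  "meromorphic_one_form X A \<omega> \<longleftrightarrow>
     (\<forall>p\<in>topspace X. \<exists>U g \<eta>. openin X U \<and> p \<in> U \<and>
        holo_fun A U g \<and> X interior_of {x\<in>U. g x = 0} = {} \<and>
        hol_one_form A U \<eta> \<and>
        forms_agree A (U - {x\<in>U. g x = 0}) \<eta> (scale_form g \<omega>))"

text \<open>The polar divisor of \<open>\<omega>\<close> is exactly \<open>W\<close>: the product of \<open>\<omega>\<close> with a local defining function of
  \<open>W\<close> is holomorphic, while \<open>\<omega>\<close> itself extends holomorphically across no point of \<open>W\<close>; since
  \<open>W\<close> has pure codimension one, the latter gives a pole along every component.\<close>

definition simple_poles_along ::
    "'a topology \<Rightarrow> ('a, 'n::finite) chart set \<Rightarrow> 'a set \<Rightarrow> ('a, 'n) one_form \<Rightarrow> bool" where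
  "simple_poles_along X A W \<omega> \<longleftrightarrow>
     (\<forall>p\<in>W.
        (\<exists>U f \<eta>. p \<in> U \<and> local_defining_function X A W U f \<and>
           hol_one_form A U \<eta> \<and> forms_agree A (U - W) \<eta> (scale_form f \<omega>)) \<and>
        \<not> (\<exists>U \<eta>. openin X U \<and> p \<in> U \<and>
           hol_one_form A U \<eta> \<and> forms_agree A (U - W) \<eta> \<omega>))"

end

theory Submission
  imports Defs "HOL-Complex_Analysis.Cauchy_Integral_Formula"
begin

text \<open>On a domain \<open>V\<close> with a frame \<open>s\<close> of a flat trivialization, the canonical section
  of \<open>[mW]\<close> becomes the function \<open>u = f\<^sup>m / s\<close>. Another frame of the trivialization changes \<open>u\<close> by a
  constant factor only, so \<open>\<omega> = du / u\<close> is a well-defined global form. It is closed, and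
  \<open>f \<omega> = m df - f ds / s\<close> is holomorphic, so the poles are at most simple. If \<open>\<omega>\<close> extended to
  \<open>\<eta>\<close> across a point of \<open>W\<close>, then \<open>du = u \<eta>\<close> would force \<open>u = 0\<close> near that point, although \<open>W\<close>
  has empty interior.\<close>

section \<open>Calculus of complex gradients\<close>

text \<open>The delicate claim is that the form extends across no point of \<open>W\<close>. One
  expects residue \<open>m\<close> along \<open>W\<close>, but \<open>W\<close> may be singular, and
  residues would have to be computed at smooth points. The linear equation
  \<open>du = u \<eta>\<close> avoids the local structure of \<open>W\<close> and treats all its
  points alike. Its only geometric input is the empty interior of \<open>W\<close>, which holds
  because pure codimension one excludes regular points of codimension zero.

  Positivity of \<open>m\<close> makes the zero set of \<open>u\<close> equal to \<open>W\<close>;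
  for \<open>m = 0\<close> the function \<open>u = 1 / s\<close> would have no zeros, and
  \<open>du / u\<close> no poles.

  Holomorphy here means only that a complex linear Frechet derivative exists. Passing to
  \<open>W\<close> by density needs continuous partial derivatives, holomorphy of \<open>du\<close>
  needs holomorphic ones, and closedness needs symmetric second ones. All three come from the
  one-variable Cauchy integral on coordinate lines.\<close>

definition has_cgrad ::
    "(complex ^ 'n::finite \<Rightarrow> complex) \<Rightarrow> complex ^ 'n \<Rightarrow> complex ^ 'n \<Rightarrow> bool" where
  "has_cgrad f a z \<longleftrightarrow> (f has_derivative (\<lambda>v. \<Sum>k\<in>UNIV. a $ k * v $ k)) (at z)"

lemma sum_mult_axis: "(\<Sum>k\<in>UNIV. a $ k * axis j c $ k) = a $ j * (c::complex)"
proof -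
  have "(\<Sum>k\<in>UNIV. a $ k * axis j c $ k) = (\<Sum>k\<in>UNIV. if k = j then a $ j * c else 0)"
    by (rule sum.cong) (auto simp: axis_def)
  then show ?thesis
    by simp
qed

text \<open>Uniqueness of the Frechet derivative: a gradient is computed with the rules for
  \<open>has_cgrad\<close> and then read off as \<open>cgrad\<close>.\<close>

lemma has_cgrad_imp_cgrad:
  assumes "has_cgrad f a z"
  shows "cgrad f z = a"
  by (simp add: cgrad_def vec_eq_iff sum_mult_axis
      frechet_derivative_at[OF assms[unfolded has_cgrad_def], symmetric])

lemma clinear_eq_sum:
  fixes D :: "complex ^ 'n::finite \<Rightarrow> complex"
  assumes "linear D" "\<And>a v. D (a *s v) = a * D v"
  shows "D v = (\<Sum>k\<in>UNIV. D (axis k 1) * v $ k)"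
proof -
  have "D v = D (\<Sum>k\<in>UNIV. v $ k *s axis k 1)"
    by (simp add: basis_expansion)
  also have "\<dots> = (\<Sum>k\<in>UNIV. D (axis k 1) * v $ k)"
    by (simp add: linear_sum[OF assms(1)] assms(2) mult.commute)
  finally show ?thesis .
qed

lemma holo_on_imp_has_cgrad:
  assumes "holo_on f S" "z \<in> S"
  shows "has_cgrad f (cgrad f z) z"
proof -
  obtain D where D: "(f has_derivative D) (at z)" "\<And>a v. D (a *s v) = a * D v"
    using assms unfolding holo_on_def by blast
  have "D = (\<lambda>v. \<Sum>k\<in>UNIV. D (axis k 1) * v $ k)"
    using clinear_eq_sum[OF has_derivative_linear[OF D(1)] D(2)] by blast
  moreover have "cgrad f z $ k = D (axis k 1)" for k
    using frechet_derivative_at[OF D(1)] by (simp add: cgrad_def)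
  ultimately show ?thesis
    using D(1) by (simp add: has_cgrad_def)
qed

lemma holo_onI:
  assumes "\<And>z. z \<in> S \<Longrightarrow> has_cgrad f (a z) z"
  shows "holo_on f S"
  unfolding holo_on_def
proof
  fix z assume "z \<in> S"
  then have "has_cgrad f (a z) z" by (rule assms)
  moreover have "(\<Sum>k\<in>UNIV. a z $ k * (c *s v) $ k) = c * (\<Sum>k\<in>UNIV. a z $ k * v $ k)" for c v
    by (simp add: sum_distrib_left mult_ac)
  ultimately show "\<exists>D. (f has_derivative D) (at z) \<and> (\<forall>a v. D (a *s v) = a * D v)"
    unfolding has_cgrad_def by blast
qed

lemma has_cgrad_const: "has_cgrad (\<lambda>_. c) 0 z"
  by (simp add: has_cgrad_def)

lemma has_cgrad_add:
  assumes "has_cgrad f a z" "has_cgrad g b z"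
  shows "has_cgrad (\<lambda>w. f w + g w) (a + b) z"
  using has_derivative_add[OF assms[unfolded has_cgrad_def]]
  by (simp add: has_cgrad_def algebra_simps sum.distrib)

lemma has_cgrad_mult:
  assumes "has_cgrad f a z" "has_cgrad g b z"
  shows "has_cgrad (\<lambda>w. f w * g w) (f z *s b + g z *s a) z"
  using has_derivative_mult[OF assms[unfolded has_cgrad_def]]
  by (simp add: has_cgrad_def algebra_simps sum.distrib sum_distrib_left sum_distrib_right)

text \<open>A one-variable outer function covers scalar multiples, powers and inverses at
  once.\<close>

lemma has_cgrad_field_compose:
  assumes "has_cgrad f a z" "(F has_field_derivative F') (at (f z))"
  shows "has_cgrad (\<lambda>w. F (f w)) (F' *s a) z"
  using has_derivative_compose[OF assms(1)[unfolded has_cgrad_def]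
      assms(2)[unfolded has_field_derivative_def]]
  by (simp add: has_cgrad_def algebra_simps sum_distrib_left)

lemma has_cgrad_cmult: "has_cgrad f a z \<Longrightarrow> has_cgrad (\<lambda>w. c * f w) (c *s a) z"
  by (erule has_cgrad_field_compose) (auto intro!: derivative_eq_intros)

lemma has_cgrad_shift:
  assumes "has_cgrad f a (z + c)"
  shows "has_cgrad (\<lambda>w. f (w + c)) a z"
  using has_derivative_compose[of "\<lambda>w. w + c" "\<lambda>v. v" z UNIV, OF _ assms[unfolded has_cgrad_def]]
    has_derivative_add[OF has_derivative_ident has_derivative_const[of c], of "at z"]
  by (simp add: has_cgrad_def)

lemma has_cgrad_power:
  assumes "has_cgrad f a z"
  shows "has_cgrad (\<lambda>w. f w ^ m) ((of_nat m * f z ^ (m - 1)) *s a) z"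
  by (rule has_cgrad_field_compose[OF assms]) (auto intro!: derivative_eq_intros)

lemma has_cgrad_inverse:
  assumes "has_cgrad f a z" "f z \<noteq> 0"
  shows "has_cgrad (\<lambda>w. inverse (f w)) ((- (inverse (f z))\<^sup>2) *s a) z"
  by (rule has_cgrad_field_compose[OF assms(1)])
     (use assms(2) in \<open>auto intro!: derivative_eq_intros simp: power2_eq_square\<close>)

lemma has_cgrad_transform_open:
  assumes "has_cgrad f a z" "open S" "z \<in> S" "\<And>w. w \<in> S \<Longrightarrow> f w = g w"
  shows "has_cgrad g a z"
  using assms unfolding has_cgrad_def by (blast intro: has_derivative_transform_within_open)

lemma bounded_linear_axis: "bounded_linear (axis k :: complex \<Rightarrow> complex ^ 'n::finite)"
proof -
  have "linear (axis k :: complex \<Rightarrow> complex ^ 'n)"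
    by (rule linearI) (auto simp: axis_def vec_eq_iff)
  then show ?thesis
    by (simp add: linear_conv_bounded_linear)
qed

text \<open>The inner map is treated componentwise because transition maps are given as holomorphic
  in each coordinate; the sum of \<open>axis\<close> terms reassembles the vector-valued
  derivative.\<close>

lemma has_cgrad_compose:
  fixes \<psi> :: "complex ^ 'm::finite \<Rightarrow> complex ^ 'n::finite"
  assumes "has_cgrad f a (\<psi> z)" "\<And>l. has_cgrad (\<lambda>w. \<psi> w $ l) (b l) z"
  shows "has_cgrad (\<lambda>w. f (\<psi> w)) (\<Sum>l\<in>UNIV. a $ l *s b l) z"
proof -
  have "((\<lambda>w. \<Sum>l\<in>UNIV. axis l (\<psi> w $ l)) has_derivative
      (\<lambda>v. \<Sum>l\<in>UNIV. axis l (\<Sum>k\<in>UNIV. b l $ k * v $ k))) (at z)"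
    by (intro has_derivative_sum bounded_linear.has_derivative[OF bounded_linear_axis]
        assms(2)[unfolded has_cgrad_def])
  moreover have sum_axis: "(\<Sum>l\<in>UNIV. axis l (c l)) = (\<chi> l. c l)" for c :: "'n \<Rightarrow> complex"
    by (simp add: vec_eq_iff axis_def if_distrib cong: if_cong)
  ultimately have "(\<psi> has_derivative (\<lambda>v. \<chi> l. \<Sum>k\<in>UNIV. b l $ k * v $ k)) (at z)"
    by simp
  from has_derivative_compose[OF this assms(1)[unfolded has_cgrad_def]]
  have "((\<lambda>w. f (\<psi> w)) has_derivative
      (\<lambda>v. \<Sum>l\<in>UNIV. a $ l * (\<Sum>k\<in>UNIV. b l $ k * v $ k))) (at z)"
    by simp
  also have "(\<lambda>v. \<Sum>l\<in>UNIV. a $ l * (\<Sum>k\<in>UNIV. b l $ k * v $ k))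
      = (\<lambda>v. \<Sum>k\<in>UNIV. (\<Sum>l\<in>UNIV. a $ l *s b l) $ k * v $ k)"
    by (rule ext, simp add: sum_distrib_left sum_distrib_right mult_ac, rule sum.swap)
  finally show ?thesis
    by (simp add: has_cgrad_def)
qed

section \<open>Locality and algebra of holomorphic functions\<close>

lemma cgrad_cong_open:
  assumes "open S" "z \<in> S" "\<And>w. w \<in> S \<Longrightarrow> f w = g w"
  shows "cgrad f z = cgrad g z"
proof -
  have "(f has_derivative D) (at z) \<longleftrightarrow> (g has_derivative D) (at z)" for D
    using assms has_derivative_transform_within_open by metis
  then show ?thesis
    by (simp add: cgrad_def frechet_derivative_def)
qed

lemma holo_on_cong_open:
  assumes "holo_on f S" "open S" "\<And>w. w \<in> S \<Longrightarrow> f w = g w"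
  shows "holo_on g S"
  by (rule holo_onI[where a = "cgrad f"])
     (rule has_cgrad_transform_open[OF holo_on_imp_has_cgrad[OF assms(1)] assms(2) _ assms(3)])

lemma holo_on_subset: "holo_on f S \<Longrightarrow> T \<subseteq> S \<Longrightarrow> holo_on f T"
  by (auto simp: holo_on_def)

lemma holo_on_const: "holo_on (\<lambda>_. c) S"
  by (rule holo_onI) (rule has_cgrad_const)

lemma holo_on_add: "holo_on f S \<Longrightarrow> holo_on g S \<Longrightarrow> holo_on (\<lambda>z. f z + g z) S"
  by (rule holo_onI) (blast intro: has_cgrad_add holo_on_imp_has_cgrad)

lemma holo_on_mult: "holo_on f S \<Longrightarrow> holo_on g S \<Longrightarrow> holo_on (\<lambda>z. f z * g z) S"
  by (rule holo_onI) (blast intro: has_cgrad_mult holo_on_imp_has_cgrad)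

lemma holo_on_power: "holo_on f S \<Longrightarrow> holo_on (\<lambda>z. f z ^ m) S"
  by (rule holo_onI) (blast intro: has_cgrad_power holo_on_imp_has_cgrad)

lemma holo_on_inverse:
  "holo_on f S \<Longrightarrow> (\<And>z. z \<in> S \<Longrightarrow> f z \<noteq> 0) \<Longrightarrow> holo_on (\<lambda>z. inverse (f z)) S"
  by (rule holo_onI) (blast intro: has_cgrad_inverse holo_on_imp_has_cgrad)

lemma holo_on_imp_continuous_on: "holo_on f S \<Longrightarrow> continuous_on S f"
  unfolding holo_on_def
  by (meson continuous_at_imp_continuous_on has_derivative_continuous)

lemma norm_axis: "norm (axis k c :: complex ^ 'n::finite) = norm c"
  by (simp add: norm_eq_sqrt_inner inner_axis_axis)


section \<open>Holomorphy of partial derivatives\<close>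

lemma has_field_derivative_slice:
  fixes f :: "complex ^ 'n::finite \<Rightarrow> complex"
  assumes "has_cgrad f a (z + axis k \<zeta>)"
  shows "((\<lambda>\<zeta>. f (z + axis k \<zeta>)) has_field_derivative a $ k) (at \<zeta>)"
proof -
  have "((\<lambda>\<zeta>. z + axis k \<zeta>) has_derivative axis k) (at \<zeta>)"
    by (auto intro!: derivative_eq_intros bounded_linear.has_derivative[OF bounded_linear_axis])
  from has_derivative_compose[OF this assms[unfolded has_cgrad_def]]
  show ?thesis
    by (simp add: has_field_derivative_def sum_mult_axis)
qed

text \<open>Restriction to the complex line through \<open>z\<close> in direction \<open>k\<close>
  reduces this to Cauchy's formula for a derivative in one variable. Once the circle is
  parametrized, \<open>z\<close> occurs only in the argument of \<open>f\<close>, which is the form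
  needed for differentiating in \<open>z\<close> under the integral.\<close>

lemma cgrad_Cauchy_integral:
  fixes f :: "complex ^ 'n::finite \<Rightarrow> complex"
  assumes "holo_on f S" "0 < r" "cball z r \<subseteq> S"
  shows "cgrad f z $ k
    = integral {0..1} (\<lambda>t. f (z + axis k (circlepath 0 r t)) / circlepath 0 r t)"
proof -
  define F where "F \<zeta> = f (z + axis k \<zeta>)" for \<zeta>
  have F: "(F has_field_derivative cgrad f (z + axis k \<zeta>) $ k) (at \<zeta>)" if "\<zeta> \<in> cball 0 r" for \<zeta>
  proof -
    have "z + axis k \<zeta> \<in> cball z r"
      using that by (simp add: dist_norm norm_axis)
    then show ?thesis
      unfolding F_def
      using assms has_field_derivative_slice holo_on_imp_has_cgrad by blast
  qed
  have "(F has_field_derivative 1 / (2 * of_real pi * \<i>) *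
      contour_integral (circlepath 0 r) (\<lambda>u. F u / (u - 0)\<^sup>2)) (at 0)"
  proof (rule Cauchy_derivative_integral_circlepath)
    show "continuous_on (cball 0 r) F"
      using F DERIV_isCont by (blast intro: continuous_at_imp_continuous_on)
    show "F holomorphic_on ball 0 r"
      using F by (auto simp: holomorphic_on_open intro!: exI F)
  qed (use assms in auto)
  moreover have "(F has_field_derivative cgrad f z $ k) (at 0)"
    using F[of 0] assms(2) bounded_linear_axis[of k, THEN bounded_linear.linear, THEN linear_0]
    by simp
  ultimately have "cgrad f z $ k
      = 1 / (2 * of_real pi * \<i>) * contour_integral (circlepath 0 r) (\<lambda>u. F u / (u - 0)\<^sup>2)"
    by (rule DERIV_unique[rotated])
  also have "\<dots> = integral {0..1} (\<lambda>t. 1 / (2 * of_real pi * \<i>) *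
      (F (circlepath 0 r t) / (circlepath 0 r t)\<^sup>2 * vector_derivative (circlepath 0 r) (at t)))"
    by (simp only: contour_integral_integral diff_zero integral_mult_right)
  also have "\<dots> = integral {0..1} (\<lambda>t. F (circlepath 0 r t) / circlepath 0 r t)"
  proof (rule integral_cong)
    fix t :: real
    \<comment> \<open>The velocity cancels the prefactor and one of the two powers in the
      denominator.\<close>
    have "vector_derivative (circlepath 0 r) (at t) = 2 * pi * \<i> * circlepath 0 r t"
      by (simp add: vector_derivative_circlepath) (simp add: circlepath)
    moreover have "circlepath 0 r t \<noteq> 0"
      using assms(2) by (simp add: circlepath)
    ultimately show "1 / (2 * of_real pi * \<i>) *
      (F (circlepath 0 r t) / (circlepath 0 r t)\<^sup>2 * vector_derivative (circlepath 0 r) (at t))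
      = F (circlepath 0 r t) / circlepath 0 r t"
      by (simp add: power2_eq_square)
  qed
  finally show ?thesis
    by (simp add: F_def)
qed

lemma norm_circlepath_0: "0 < r \<Longrightarrow> norm (circlepath 0 r t) = r"
  by (simp add: circlepath norm_mult)

lemma continuous_on_circlepath_slice:
  fixes g :: "complex ^ 'n::finite \<Rightarrow> complex"
  assumes "continuous_on S g" "0 < r" "\<And>z. z \<in> T \<Longrightarrow> cball z r \<subseteq> S"
  shows "continuous_on (T \<times> cbox 0 1)
    (\<lambda>(z, t). g (z + axis k (circlepath 0 r t)) / circlepath 0 r t)"
proof -
  have c: "continuous_on U (\<lambda>x. circlepath 0 r (h x))" if "continuous_on U h" for U :: "'b::topological_space set" and h
    unfolding circlepath by (intro continuous_intros that)
  have ne: "circlepath 0 r t \<noteq> 0" for t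
    using assms(2) by (simp add: circlepath)
  have "continuous_on (T \<times> cbox 0 1) (\<lambda>x. g (fst x + axis k (circlepath 0 r (snd x))))"
  proof (rule continuous_on_compose2[OF assms(1)])
    show "continuous_on (T \<times> cbox 0 1)
        (\<lambda>x. fst x + axis k (circlepath 0 r (snd x)))"
      by (intro continuous_intros bounded_linear.continuous_on[OF bounded_linear_axis] c)
    have "z + axis k (circlepath 0 r t) \<in> cball z r" for z :: "complex ^ 'n" and t
      using assms(2) by (simp add: dist_norm norm_axis norm_circlepath_0)
    then show "(\<lambda>x. fst x + axis k (circlepath 0 r (snd x))) ` (T \<times> cbox 0 1) \<subseteq> S"
      using assms(3) by fastforce
  qed
  then show ?thesis
    by (auto simp: split_beta intro!: continuous_intros c ne)
qed

lemma continuous_on_Pair_slice: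
  assumes "continuous_on (S \<times> T) (\<lambda>(x, y). h x y)" "x \<in> S"
  shows "continuous_on T (h x)"
proof -
  have "continuous_on T (\<lambda>y. (x, y))"
    by (intro continuous_intros)
  from continuous_on_compose2[OF assms(1) this] show ?thesis
    using assms(2) by (simp add: image_subset_iff)
qed

text \<open>One radius has to serve all centres \<open>w\<close> near \<open>z\<close>, so that
  circles of fixed size represent a partial derivative on a whole neighbourhood.\<close>

lemma ex_nested_ball:
  fixes z :: "'a::real_normed_vector"
  assumes "open S" "z \<in> S"
  obtains r where "0 < r" "ball z r \<subseteq> S" "\<And>w. w \<in> ball z r \<Longrightarrow> cball w r \<subseteq> S"
proof -
  obtain e where e: "e > 0" "ball z e \<subseteq> S"
    using assms open_contains_ball by blast
  have "cball w (e/2) \<subseteq> ball z e" if "w \<in> ball z (e/2)" for w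
  proof
    fix y assume "y \<in> cball w (e/2)"
    then show "y \<in> ball z e"
      using that dist_triangle[of z y w] by simp
  qed
  then show ?thesis
    using e by (intro that[of "e/2"]) (auto intro: subset_trans)
qed

text \<open>Cauchy's formula expresses the partial derivative by values of \<open>f\<close> alone,
  and \<open>f\<close> is continuous. Continuity has to precede differentiability: the Leibniz rule
  requires a continuous derivative of the integrand, and that derivative contains
  \<open>cgrad f\<close>.\<close>

lemma continuous_on_cgrad:
  fixes f :: "complex ^ 'n::finite \<Rightarrow> complex"
  assumes "open S" "holo_on f S"
  shows "continuous_on S (\<lambda>z. cgrad f z $ k)"
proof (rule continuous_at_imp_continuous_on, rule ballI)
  fix z assume "z \<in> S"
  then obtain r where r: "0 < r" "ball z r \<subseteq> S" "\<And>w. w \<in> ball z r \<Longrightarrow> cball w r \<subseteq> S"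
    using ex_nested_ball assms(1) by blast
  have "continuous_on (ball z r)
      (\<lambda>z. integral (cbox 0 1) (\<lambda>t. f (z + axis k (circlepath 0 r t)) / circlepath 0 r t))"
    by (rule integral_continuous_on_param)
       (rule continuous_on_circlepath_slice[OF holo_on_imp_continuous_on[OF assms(2)] r(1,3)])
  then have "continuous_on (ball z r) (\<lambda>z. cgrad f z $ k)"
    using r by (subst continuous_on_cong[OF refl cgrad_Cauchy_integral[OF assms(2)]]) auto
  then show "isCont (\<lambda>z. cgrad f z $ k) z"
    by (rule continuous_on_interior) (simp add: r(1))
qed

text \<open>Differentiation under the integral sign in Cauchy's formula.\<close>

lemma has_cgrad_cgrad:
  fixes f :: "complex ^ 'n::finite \<Rightarrow> complex"
  assumes "open S" "holo_on f S" "z \<in> S"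
  obtains r where "0 < r" "cball z r \<subseteq> S"
    "has_cgrad (\<lambda>w. cgrad f w $ k) (\<chi> j. integral {0..1}
        (\<lambda>t. cgrad f (z + axis k (circlepath 0 r t)) $ j / circlepath 0 r t)) z"
proof -
  obtain r where r: "0 < r" "ball z r \<subseteq> S" "\<And>w. w \<in> ball z r \<Longrightarrow> cball w r \<subseteq> S"
    using ex_nested_ball assms(1,3) by blast
  define \<gamma> where "\<gamma> = circlepath 0 r"
  define D where "D w t v = (\<Sum>j\<in>UNIV. cgrad f (w + axis k (\<gamma> t)) $ j / \<gamma> t * v $ j)" for w t v
  have blin: "bounded_linear (D w t)" for w t
    unfolding D_def
    by (intro bounded_linear_sum bounded_linear_const_mult bounded_linear_vec_nth)
  have inS: "w + axis k (\<gamma> t) \<in> S" if "w \<in> ball z r" for w t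
  proof -
    have "w + axis k (\<gamma> t) \<in> cball w r"
      using r(1) by (simp add: \<gamma>_def dist_norm norm_axis norm_circlepath_0)
    with r(3)[OF that] show ?thesis by blast
  qed
  have contf: "continuous_on (ball z r \<times> cbox 0 1) (\<lambda>(w, t). f (w + axis k (\<gamma> t)) / \<gamma> t)"
    unfolding \<gamma>_def
    by (rule continuous_on_circlepath_slice[OF holo_on_imp_continuous_on[OF assms(2)] r(1,3)])
  have contD: "continuous_on (ball z r \<times> cbox 0 1) (\<lambda>(w, t). cgrad f (w + axis k (\<gamma> t)) $ j / \<gamma> t)" for j
    unfolding \<gamma>_def
    by (rule continuous_on_circlepath_slice[OF continuous_on_cgrad[OF assms(1,2)] r(1,3)])
  \<comment> \<open>The Leibniz rule asks for continuity in operator norm; in finite dimension it is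
    enough to test it on each fixed vector \<open>v\<close>.\<close>
  have contB: "continuous_on (ball z r \<times> cbox 0 1) (\<lambda>(w, t). Blinfun (D w t))"
  proof -
    have "continuous_on (ball z r \<times> cbox 0 1) (\<lambda>x. \<Sum>j\<in>UNIV.
          cgrad f (fst x + axis k (\<gamma> (snd x))) $ j / \<gamma> (snd x) * v $ j)" for v
      by (intro continuous_intros contD[unfolded split_beta])
    then have "continuous_on (ball z r \<times> cbox 0 1) (\<lambda>x. blinfun_apply (Blinfun (D (fst x) (snd x))) v)" for v
      by (simp add: bounded_linear_Blinfun_apply blin D_def)
    then show ?thesis
      unfolding split_beta continuous_on_eq_continuous_within
      by (intro ballI continuous_blinfun_componentwiseI1) blast
  qed
  have "((\<lambda>w. integral (cbox 0 1) (\<lambda>t. f (w + axis k (\<gamma> t)) / \<gamma> t)) has_derivative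
      blinfun_apply (integral (cbox 0 1) (\<lambda>t. Blinfun (D z t)))) (at z within ball z r)"
  proof (rule leibniz_rule[OF _ _ contB])
    fix w t assume "w \<in> ball z r" 
    then have "has_cgrad f (cgrad f (w + axis k (\<gamma> t))) (w + axis k (\<gamma> t))"
      using assms(2) inS holo_on_imp_has_cgrad by blast
    then have "has_cgrad (\<lambda>w. inverse (\<gamma> t) * f (w + axis k (\<gamma> t)))
        (inverse (\<gamma> t) *s cgrad f (w + axis k (\<gamma> t))) w"
      by (intro has_cgrad_cmult has_cgrad_shift)
    then have "((\<lambda>w. f (w + axis k (\<gamma> t)) / \<gamma> t) has_derivative D w t) (at w)"
      by (simp add: has_cgrad_def D_def[abs_def] divide_inverse mult_ac)
    then show "((\<lambda>w. f (w + axis k (\<gamma> t)) / \<gamma> t) has_derivative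
        blinfun_apply (Blinfun (D w t))) (at w within ball z r)"
      by (simp add: bounded_linear_Blinfun_apply blin has_derivative_at_withinI)
  next
    fix w assume "w \<in> ball z r"
    then have "continuous_on (cbox 0 1) (\<lambda>t. f (w + axis k (\<gamma> t)) / \<gamma> t)"
      by (rule continuous_on_Pair_slice[OF contf])
    then show "(\<lambda>t. f (w + axis k (\<gamma> t)) / \<gamma> t) integrable_on cbox 0 1"
      by (rule integrable_continuous)
  qed (use r in auto)
  then have 1: "((\<lambda>w. integral (cbox 0 1) (\<lambda>t. f (w + axis k (\<gamma> t)) / \<gamma> t)) has_derivative
      blinfun_apply (integral (cbox 0 1) (\<lambda>t. Blinfun (D z t)))) (at z)"
    using r(1) by (subst (asm) at_within_open) auto
  have 2: "((\<lambda>w. cgrad f w $ k) has_derivative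
      blinfun_apply (integral (cbox 0 1) (\<lambda>t. Blinfun (D z t)))) (at z)"
  proof (rule has_derivative_transform_within_open[OF 1 open_ball])
    show "z \<in> ball z r"
      using r(1) by simp
    show "integral (cbox 0 1) (\<lambda>t. f (w + axis k (\<gamma> t)) / \<gamma> t) = cgrad f w $ k"
      if "w \<in> ball z r" for w
      using cgrad_Cauchy_integral[OF assms(2) r(1) r(3)[OF that]] by (simp add: \<gamma>_def)
  qed
  \<comment> \<open>Evaluation at \<open>v\<close> commutes with the integral, so the
    operator-valued integral splits into one scalar integral for each component of the
    gradient.\<close>
  have "(\<lambda>t. Blinfun (D z t)) integrable_on cbox 0 1"
    using r(1) by (intro integrable_continuous continuous_on_Pair_slice[OF contB]) simp
  then have 3: "blinfun_apply (integral (cbox 0 1) (\<lambda>t. Blinfun (D z t))) v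
      = integral (cbox 0 1) (\<lambda>t. D z t v)" for v
    by (simp add: blinfun_apply_integral bounded_linear_Blinfun_apply blin)
  have "(\<lambda>t. cgrad f (z + axis k (\<gamma> t)) $ j / \<gamma> t) integrable_on cbox 0 1" for j
    using r(1) by (intro integrable_continuous continuous_on_Pair_slice[OF contD]) simp
  then have "blinfun_apply (integral (cbox 0 1) (\<lambda>t. Blinfun (D z t))) = (\<lambda>v. \<Sum>j\<in>UNIV.
      integral (cbox 0 1) (\<lambda>t. cgrad f (z + axis k (\<gamma> t)) $ j / \<gamma> t) * v $ j)"
    by (intro ext, unfold 3 D_def, subst integral_sum)
       (simp_all only: integral_mult_left integrable_on_mult_left finite)
  with 2 have "has_cgrad (\<lambda>w. cgrad f w $ k) (\<chi> j. integral {0..1}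
        (\<lambda>t. cgrad f (z + axis k (circlepath 0 r t)) $ j / circlepath 0 r t)) z"
    by (simp add: has_cgrad_def \<gamma>_def)
  moreover have "cball z r \<subseteq> S"
    using r by auto
  ultimately show ?thesis
    using that r(1) by blast
qed

lemma holo_on_cgrad:
  assumes "open S" "holo_on f S"
  shows "holo_on (\<lambda>z. cgrad f z $ k) S"
proof (rule holo_onI)
  fix z assume "z \<in> S"
  then obtain a where "has_cgrad (\<lambda>w. cgrad f w $ k) a z"
    by (rule has_cgrad_cgrad[OF assms])
  then show "has_cgrad (\<lambda>w. cgrad f w $ k) (cgrad (\<lambda>w. cgrad f w $ k) z) z"
    using has_cgrad_imp_cgrad by metis
qed

text \<open>Both sides are the same integral. Differentiating Cauchy's formula for the
  \<open>k\<close>-th partial derivative gives, in component \<open>j\<close>, an integral of the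
  \<open>j\<close>-th partial derivative over a circle in direction \<open>k\<close>; by Cauchy's
  formula again, this is the \<open>k\<close>-th partial derivative of the \<open>j\<close>-th
  one.\<close>

lemma cgrad_commute:
  assumes "open S" "holo_on f S" "z \<in> S"
  shows "cgrad (\<lambda>w. cgrad f w $ k) z $ j = cgrad (\<lambda>w. cgrad f w $ j) z $ k"
proof -
  obtain r where r: "0 < r" "cball z r \<subseteq> S"
    "has_cgrad (\<lambda>w. cgrad f w $ k) (\<chi> j. integral {0..1}
        (\<lambda>t. cgrad f (z + axis k (circlepath 0 r t)) $ j / circlepath 0 r t)) z"
    by (rule has_cgrad_cgrad[OF assms])
  then show ?thesis
    using cgrad_Cauchy_integral[OF holo_on_cgrad[OF assms(1,2)] r(1,2)]
    by (simp add: has_cgrad_imp_cgrad)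
qed

section \<open>Uniqueness for the equation \<open>du = u \<theta>\<close>\<close>

text \<open>Along a segment the equation becomes a linear ordinary differential equation, solved by an
  integrating factor.\<close>

lemma logarithmic_ode_zero:
  fixes u :: "complex ^ 'n::finite \<Rightarrow> complex"
  assumes S: "convex S" and u: "holo_on u S"
    and \<theta>: "\<And>k. continuous_on S (\<lambda>z. \<theta> z $ k)"
    and ode: "\<And>z. z \<in> S \<Longrightarrow> cgrad u z = u z *s \<theta> z"
    and p: "p \<in> S" "u p = 0" and q: "q \<in> S"
  shows "u q = 0"
proof -
  define \<gamma> where "\<gamma> t = p + t *\<^sub>R (q - p)" for t
  define g where "g t = u (\<gamma> t)" for t
  define h where "h t = (\<Sum>k\<in>UNIV. \<theta> (\<gamma> t) $ k * (q - p) $ k)" for t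
  \<comment> \<open>\<open>H\<close> is a primitive of the coefficient in \<open>g' = g h\<close>,
    so \<open>exp (- H t)\<close> is the integrating factor.\<close>
  define H where "H t = integral {0..t} h" for t
  have \<gamma>S: "\<gamma> t \<in> S" if "t \<in> {0..1}" for t
  proof -
    have "\<gamma> t = (1 - t) *\<^sub>R p + t *\<^sub>R q"
      by (simp add: \<gamma>_def algebra_simps)
    then show ?thesis
      using convexD_alt[OF S p(1) q] that by simp
  qed
  have "continuous_on {0..1} (\<lambda>t. \<theta> (\<gamma> t) $ k)" for k
    by (rule continuous_on_compose2[OF \<theta>]) (auto simp: \<gamma>_def[abs_def] intro!: continuous_intros \<gamma>S[unfolded \<gamma>_def])
  then have h: "continuous_on {0..1} h"
    unfolding h_def by (intro continuous_on_sum continuous_on_mult continuous_on_const)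
  have g: "(g has_vector_derivative g t * h t) (at t within {0..1})" if "t \<in> {0..1}" for t
  proof -
    have "(\<gamma> has_derivative (\<lambda>s. s *\<^sub>R (q - p))) (at t within {0..1})"
      unfolding \<gamma>_def by (auto intro!: derivative_eq_intros)
    moreover have "has_cgrad u (u (\<gamma> t) *s \<theta> (\<gamma> t)) (\<gamma> t)"
      using holo_on_imp_has_cgrad[OF u \<gamma>S] ode[OF \<gamma>S] that by metis
    ultimately have "((\<lambda>t. u (\<gamma> t)) has_derivative
        (\<lambda>s. \<Sum>k\<in>UNIV. (u (\<gamma> t) *s \<theta> (\<gamma> t)) $ k * (s *\<^sub>R (q - p)) $ k)) (at t within {0..1})"
      unfolding has_cgrad_def by (rule has_derivative_compose)
    moreover have "(\<Sum>k\<in>UNIV. (u (\<gamma> t) *s \<theta> (\<gamma> t)) $ k * (s *\<^sub>R (q - p)) $ k) = s *\<^sub>R (g t * h t)" for s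
      by (simp add: g_def h_def sum_distrib_left scaleR_sum_right mult_ac)
    ultimately show ?thesis
      by (simp add: has_vector_derivative_def g_def[abs_def])
  qed
  have "((\<lambda>t. g t * exp (- H t)) has_vector_derivative 0) (at t within {0..1})"
    if t: "t \<in> {0..1}" for t
  proof -
    have "((\<lambda>t. - H t) has_vector_derivative - h t) (at t within {0..1})"
      unfolding H_def
      by (rule has_vector_derivative_minus[OF integral_has_vector_derivative[OF h t]])
    then have "((exp \<circ> (\<lambda>t. - H t)) has_vector_derivative - h t * exp (- H t)) (at t within {0..1})"
      by (rule field_vector_diff_chain_within) (rule has_field_derivative_at_within[OF DERIV_exp])
    from has_vector_derivative_mult[OF g[OF t] this] show ?thesis
      by (simp add: o_def algebra_simps)
  qed
  then obtain c where c: "\<And>t. t \<in> {0..1} \<Longrightarrow> g t * exp (- H t) = c"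
    using has_vector_derivative_zero_constant[OF convex_real_interval(5)] by blast
  \<comment> \<open>The constant is zero by its value at \<open>t = 0\<close>; as the exponential
    never vanishes, \<open>g\<close> is zero at the other end too.\<close>
  have "g 0 = 0" "g 1 = u q"
    using p(2) by (simp_all add: g_def \<gamma>_def)
  then show ?thesis
    using c[of 0] c[of 1] by simp
qed

section \<open>Functions and one-forms on a manifold\<close>

lemma coord_rep_apply: "coord_rep c f z = f (inv_into (fst c) (snd c) z)"
  by (simp add: coord_rep_def)

definition d_form :: "('a \<Rightarrow> complex) \<Rightarrow> ('a, 'n::finite) one_form" where
  "d_form f = (\<lambda>c. cgrad (coord_rep c f))"

text \<open>Dividing the differential avoids a branch of the logarithm. Since
  \<open>inverse 0 = 0\<close>, the form is zero at zeros of \<open>u\<close>, so that proportional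
  functions have equal forms even there.\<close>

definition dlog_form :: "('a \<Rightarrow> complex) \<Rightarrow> ('a, 'n::finite) one_form" where
  "dlog_form u = scale_form (\<lambda>x. inverse (u x)) (d_form u)"

lemma dlog_form_apply:
  "dlog_form u c z = inverse (coord_rep c u z) *s cgrad (coord_rep c u) z"
  by (simp add: dlog_form_def scale_form_def d_form_def coord_rep_apply)

lemma holo_funD: "holo_fun A V f \<Longrightarrow> c \<in> A \<Longrightarrow> holo_on (coord_rep c f) (snd c ` (fst c \<inter> V))"
  by (simp add: holo_fun_def)

lemma holo_fun_subset: "holo_fun A V f \<Longrightarrow> V' \<subseteq> V \<Longrightarrow> holo_fun A V' f"
  unfolding holo_fun_def by (blast intro: holo_on_subset)

lemma holo_fun_const: "holo_fun A V (\<lambda>_. k)"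
  by (simp add: holo_fun_def coord_rep_def o_def holo_on_const)

lemma holo_fun_mult: "holo_fun A V f \<Longrightarrow> holo_fun A V g \<Longrightarrow> holo_fun A V (\<lambda>x. f x * g x)"
  by (simp add: holo_fun_def coord_rep_def o_def holo_on_mult)

lemma holo_fun_power: "holo_fun A V f \<Longrightarrow> holo_fun A V (\<lambda>x. f x ^ m)"
  by (simp add: holo_fun_def coord_rep_def o_def holo_on_power)

text \<open>\<open>holo_on\<close> is tested point by point with derivatives in the ambient space,
  so holomorphy can be collected from sets \<open>N\<close> around the single points.\<close>

lemma holo_fun_local:
  assumes "\<And>p. p \<in> V \<Longrightarrow> \<exists>N. p \<in> N \<and> holo_fun A N f"
  shows "holo_fun A V f"
  unfolding holo_fun_def holo_on_def
proof (intro ballI)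
  fix c z assume "c \<in> A" "z \<in> snd c ` (fst c \<inter> V)"
  then obtain x where x: "x \<in> fst c" "x \<in> V" "z = snd c x"
    by blast
  then obtain N where "x \<in> N" "holo_fun A N f"
    using assms by blast
  then show "\<exists>D. (coord_rep c f has_derivative D) (at z) \<and> (\<forall>a v. D (a *s v) = a * D v)"
    using holo_funD[of A N f c] \<open>c \<in> A\<close> x unfolding holo_on_def by blast
qed

lemma forms_agree_subset: "forms_agree A V \<eta> \<omega> \<Longrightarrow> V' \<subseteq> V \<Longrightarrow> forms_agree A V' \<eta> \<omega>"
  unfolding forms_agree_def by blast

lemma forms_agree_sym: "forms_agree A V \<eta> \<omega> \<Longrightarrow> forms_agree A V \<omega> \<eta>"
  unfolding forms_agree_def by metis

lemma forms_agree_scale: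
  "forms_agree A V \<eta> \<omega> \<Longrightarrow> forms_agree A V (scale_form f \<eta>) (scale_form f \<omega>)"
  unfolding forms_agree_def scale_form_def by simp

lemma forms_agree_trans:
  "forms_agree A V \<eta> \<omega> \<Longrightarrow> forms_agree A V \<omega> \<zeta> \<Longrightarrow> forms_agree A V \<eta> \<zeta>"
  unfolding forms_agree_def by simp

lemma hol_one_form_subset: "hol_one_form A V \<omega> \<Longrightarrow> V' \<subseteq> V \<Longrightarrow> hol_one_form A V' \<omega>"
  unfolding hol_one_form_def by (blast intro: holo_on_subset)

lemma hol_one_form_add:
  assumes "hol_one_form A V \<omega>" "hol_one_form A V \<eta>"
  shows "hol_one_form A V (\<lambda>c z. \<omega> c z + \<eta> c z)"
  using assms unfolding hol_one_form_def
  by (simp add: holo_on_add vector_sadd_rdistrib sum.distrib)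

section \<open>Charts, differentials and logarithmic differentials on the manifold\<close>

locale complex_manifold =
  fixes X :: "'a topology" and A :: "('a, 'n::finite) chart set"
  assumes manifold: "compact_complex_manifold X A"
begin

lemma openin_chart: "c \<in> A \<Longrightarrow> openin X (fst c)"
  using manifold unfolding compact_complex_manifold_def by fastforce

lemma homeomorphic_map_chart:
  "c \<in> A \<Longrightarrow> homeomorphic_map (subtopology X (fst c)) (top_of_set (snd c ` fst c)) (snd c)"
  using manifold unfolding compact_complex_manifold_def by fastforce

lemma open_chart_image:
  assumes "c \<in> A" "openin X V"
  shows "open (snd c ` (fst c \<inter> V))"
proof -
  have "openin (top_of_set (snd c ` fst c)) (snd c ` (fst c \<inter> V))"
    using homeomorphic_imp_open_map[OF homeomorphic_map_chart[OF assms(1)]] assms(2)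
    by (simp add: open_map_def openin_subtopology_Int2)
  moreover have "open (snd c ` fst c)"
    using manifold assms(1) unfolding compact_complex_manifold_def by fastforce
  ultimately show ?thesis
    using openin_open_trans by blast
qed

lemma openin_chart_vimage:
  assumes "c \<in> A" "open S"
  shows "openin X {x \<in> fst c. snd c x \<in> S}"
proof -
  have "continuous_map (subtopology X (fst c)) (top_of_set (snd c ` fst c)) (snd c)"
    by (rule homeomorphic_imp_continuous_map[OF homeomorphic_map_chart[OF assms(1)]])
  then have "continuous_map (subtopology X (fst c)) euclidean (snd c)"
    by (rule continuous_map_into_fulltopology)
  then have "openin (subtopology X (fst c)) {x \<in> topspace (subtopology X (fst c)). snd c x \<in> S}"
    using assms(2) by (intro openin_continuous_map_preimage) auto
  moreover have "topspace (subtopology X (fst c)) = fst c"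
    using openin_subset[OF openin_chart[OF assms(1)]] by auto
  ultimately show ?thesis
    using openin_trans_full openin_chart[OF assms(1)] by fastforce
qed

lemma inv_into_chart: "c \<in> A \<Longrightarrow> x \<in> fst c \<Longrightarrow> inv_into (fst c) (snd c) (snd c x) = x"
  using homeomorphic_imp_injective_map[OF homeomorphic_map_chart] openin_subset[OF openin_chart]
  by (metis inf.absorb_iff2 inv_into_f_f topspace_subtopology)

lemma coord_rep_chart: "c \<in> A \<Longrightarrow> x \<in> fst c \<Longrightarrow> coord_rep c f (snd c x) = f x"
  by (simp add: coord_rep_apply inv_into_chart)

lemma ex_chart: "x \<in> topspace X \<Longrightarrow> \<exists>c\<in>A. x \<in> fst c"
  using manifold unfolding compact_complex_manifold_def by auto

lemma holo_on_transition:
  "c \<in> A \<Longrightarrow> d \<in> A \<Longrightarrow> holo_on (\<lambda>z. coord_rep c (snd d) z $ l) (snd c ` (fst c \<inter> fst d))"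
  using manifold unfolding compact_complex_manifold_def by blast

lemma holo_fun_cong:
  assumes "holo_fun A V f" "openin X V" "\<And>x. x \<in> V \<Longrightarrow> f x = g x"
  shows "holo_fun A V g"
  unfolding holo_fun_def
proof
  fix c assume c: "c \<in> A"
  show "holo_on (coord_rep c g) (snd c ` (fst c \<inter> V))"
    by (rule holo_on_cong_open[OF holo_funD[OF assms(1) c] open_chart_image[OF c assms(2)]])
       (use c assms(3) in \<open>auto simp: coord_rep_chart\<close>)
qed

lemma holo_fun_inverse:
  assumes "holo_fun A V f" "\<And>x. x \<in> V \<Longrightarrow> f x \<noteq> 0"
  shows "holo_fun A V (\<lambda>x. inverse (f x))"
  unfolding holo_fun_def
proof
  fix c assume c: "c \<in> A"
  have "holo_on (\<lambda>z. inverse (coord_rep c f z)) (snd c ` (fst c \<inter> V))"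
    by (rule holo_on_inverse[OF holo_funD[OF assms(1) c]])
       (use c assms(2) in \<open>auto simp: coord_rep_chart\<close>)
  then show "holo_on (coord_rep c (\<lambda>x. inverse (f x))) (snd c ` (fst c \<inter> V))"
    by (simp add: coord_rep_def o_def)
qed

lemma openin_nonzero:
  assumes "openin X V" "holo_fun A V f"
  shows "openin X {x \<in> V. f x \<noteq> 0}"
proof -
  have *: "openin X {x \<in> fst c \<inter> V. f x \<noteq> 0}" if c: "c \<in> A" for c
  proof -
    let ?S = "snd c ` (fst c \<inter> V)"
    have "open (?S \<inter> coord_rep c f -` (- {0}))"
      by (rule continuous_open_preimage[OF holo_on_imp_continuous_on[OF holo_funD[OF assms(2) c]]])
         (auto intro: open_chart_image[OF c assms(1)])
    then have "openin X {x \<in> fst c. snd c x \<in> ?S \<inter> coord_rep c f -` (- {0})}"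
      by (rule openin_chart_vimage[OF c])
    also have "{x \<in> fst c. snd c x \<in> ?S \<inter> coord_rep c f -` (- {0})} = {x \<in> fst c \<inter> V. f x \<noteq> 0}"
      using inv_into_chart[OF c] by (auto simp: coord_rep_apply) (metis inv_into_chart[OF c])+
    finally show ?thesis .
  qed
  have "{x \<in> V. f x \<noteq> 0} = (\<Union>c\<in>A. {x \<in> fst c \<inter> V. f x \<noteq> 0})"
    using ex_chart openin_subset[OF assms(1)] by blast
  then show ?thesis
    using * by (auto intro: openin_Union)
qed

text \<open>The transformation law is the chain rule: on the open image of the overlap, the
  representation of \<open>f\<close> in \<open>c\<close> is its representation in \<open>d\<close>
  composed with the transition map.\<close>

lemma hol_one_form_d_form:
  assumes "openin X V" "holo_fun A V f"
  shows "hol_one_form A V (d_form f)"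
  unfolding hol_one_form_def
proof (intro conjI ballI allI)
  fix c k assume c: "c \<in> A"
  show "holo_on (\<lambda>z. d_form f c z $ k) (snd c ` (fst c \<inter> V))"
    unfolding d_form_def
    by (rule holo_on_cgrad[OF open_chart_image[OF c assms(1)] holo_funD[OF assms(2) c]])
next
  fix c d z assume c: "c \<in> A" and d: "d \<in> A" and "z \<in> snd c ` (fst c \<inter> fst d \<inter> V)"
  then obtain x where x: "x \<in> fst c" "x \<in> fst d" "x \<in> V" "z = snd c x"
    by blast
  let ?S = "snd c ` (fst c \<inter> (fst d \<inter> V))"
  let ?\<psi> = "coord_rep c (snd d)"
  have S: "open ?S"
    using open_chart_image[OF c] openin_chart[OF d] assms(1) by blast
  have \<psi>: "?\<psi> z = snd d x"
    using c x by (simp add: coord_rep_chart)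
  have "has_cgrad (coord_rep d f) (d_form f d (?\<psi> z)) (?\<psi> z)"
    unfolding d_form_def \<psi>
    by (rule holo_on_imp_has_cgrad[OF holo_funD[OF assms(2) d]]) (use x in auto)
  moreover have "has_cgrad (\<lambda>w. ?\<psi> w $ l) (cgrad (\<lambda>w. ?\<psi> w $ l) z) z" for l
    by (rule holo_on_imp_has_cgrad[OF holo_on_transition[OF c d]]) (use x in auto)
  ultimately have "has_cgrad (\<lambda>w. coord_rep d f (?\<psi> w))
      (\<Sum>l\<in>UNIV. d_form f d (?\<psi> z) $ l *s cgrad (\<lambda>w. ?\<psi> w $ l) z) z"
    by (rule has_cgrad_compose)
  then have "has_cgrad (coord_rep c f)
      (\<Sum>l\<in>UNIV. d_form f d (?\<psi> z) $ l *s cgrad (\<lambda>w. ?\<psi> w $ l) z) z"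
    by (rule has_cgrad_transform_open[OF _ S])
       (use x c d in \<open>auto simp: coord_rep_chart\<close>)
  then show "d_form f c z = (\<Sum>l\<in>UNIV. d_form f d (?\<psi> z) $ l *s cgrad (\<lambda>w. ?\<psi> w $ l) z)"
    by (simp add: d_form_def has_cgrad_imp_cgrad)
qed

lemma hol_one_form_scale:
  assumes "holo_fun A V g" "hol_one_form A V \<omega>"
  shows "hol_one_form A V (scale_form g \<omega>)"
  unfolding hol_one_form_def
proof (intro conjI ballI allI)
  fix c k assume c: "c \<in> A"
  then show "holo_on (\<lambda>z. scale_form g \<omega> c z $ k) (snd c ` (fst c \<inter> V))"
    using holo_on_mult[OF holo_funD[OF assms(1) c]] assms(2)
    by (simp add: scale_form_def hol_one_form_def)
next
  fix c d z assume c: "c \<in> A" and d: "d \<in> A" and z: "z \<in> snd c ` (fst c \<inter> fst d \<inter> V)"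
  then obtain x where x: "x \<in> fst c" "x \<in> fst d" "z = snd c x"
    by blast
  have "\<omega> c z = (\<Sum>l\<in>UNIV. \<omega> d (coord_rep c (snd d) z) $ l *s cgrad (\<lambda>w. coord_rep c (snd d) w $ l) z)"
    using assms(2) c d z unfolding hol_one_form_def by blast
  then show "scale_form g \<omega> c z = (\<Sum>l\<in>UNIV. scale_form g \<omega> d (coord_rep c (snd d) z) $ l *s
      cgrad (\<lambda>w. coord_rep c (snd d) w $ l) z)"
    using x c d by (simp add: scale_form_def coord_rep_chart vec.scale_sum_right)
qed

lemma hol_one_form_dlog_form:
  assumes "openin X V" "holo_fun A V u"
  shows "hol_one_form A {x \<in> V. u x \<noteq> 0} (dlog_form u)"
  unfolding dlog_form_def
  by (rule hol_one_form_scale[OF holo_fun_inverse[OF holo_fun_subset[OF assms(2)]]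
        hol_one_form_subset[OF hol_one_form_d_form[OF assms]]]) auto

text \<open>The product rule leaves two terms: second partial derivatives of \<open>u\<close> over
  \<open>u\<close>, symmetric by \<open>cgrad_commute\<close>, and a multiple of the product of the
  \<open>j\<close>-th and \<open>k\<close>-th partial derivatives, symmetric by inspection.\<close>

lemma closed_dlog_form:
  assumes "openin X V" "holo_fun A V u"
  shows "closed_one_form A {x \<in> V. u x \<noteq> 0} (dlog_form u)"
  unfolding closed_one_form_def
proof (intro ballI allI)
  fix c z j k assume c: "c \<in> A" and "z \<in> snd c ` (fst c \<inter> {x \<in> V. u x \<noteq> 0})"
  then obtain x where x: "x \<in> fst c" "x \<in> V" "u x \<noteq> 0" "z = snd c x"
    by blast
  let ?g = "coord_rep c u"
  let ?S = "snd c ` (fst c \<inter> V)"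
  have S: "open ?S" "z \<in> ?S" and g: "holo_on ?g ?S" and nz: "?g z \<noteq> 0"
    using open_chart_image[OF c assms(1)] holo_funD[OF assms(2) c] x c
    by (auto simp: coord_rep_chart)
  have "cgrad (\<lambda>w. dlog_form u c w $ k) z =
      inverse (?g z) *s cgrad (\<lambda>w. cgrad ?g w $ k) z
      + cgrad ?g z $ k *s ((- (inverse (?g z))\<^sup>2) *s cgrad ?g z)" for k
    unfolding dlog_form_apply vector_smult_component
    by (intro has_cgrad_imp_cgrad has_cgrad_mult has_cgrad_inverse nz
        holo_on_imp_has_cgrad[OF g S(2)] holo_on_imp_has_cgrad[OF holo_on_cgrad[OF S(1) g] S(2)])
  then show "cgrad (\<lambda>w. dlog_form u c w $ k) z $ j = cgrad (\<lambda>w. dlog_form u c w $ j) z $ k"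
    using cgrad_commute[OF S(1) g S(2), of k j] by simp
qed

text \<open>The differential of a constant vanishes, so a constant factor cancels in
  \<open>du / u\<close>. It is through this cancellation that flatness makes the local forms fit
  together.\<close>

lemma dlog_form_cmult:
  assumes "openin X V" "holo_fun A V u" "\<And>x. x \<in> V \<Longrightarrow> u' x = k * u x" "k \<noteq> 0"
  shows "forms_agree A V (dlog_form u') (dlog_form u)"
  unfolding forms_agree_def
proof (intro ballI)
  fix c z assume c: "c \<in> A" and z: "z \<in> snd c ` (fst c \<inter> V)"
  have "has_cgrad (\<lambda>w. k * coord_rep c u w) (k *s cgrad (coord_rep c u) z) z"
    by (rule has_cgrad_cmult[OF holo_on_imp_has_cgrad[OF holo_funD[OF assms(2) c] z]])
  then have "has_cgrad (coord_rep c u') (k *s cgrad (coord_rep c u) z) z"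
    by (rule has_cgrad_transform_open[OF _ open_chart_image[OF c assms(1)] z])
       (use c assms(3) in \<open>auto simp: coord_rep_chart\<close>)
  moreover have "coord_rep c u' z = k * coord_rep c u z"
    using z c assms(3) by (auto simp: coord_rep_chart)
  ultimately show "dlog_form u' c z = dlog_form u c z"
    using assms(4) by (simp add: dlog_form_apply has_cgrad_imp_cgrad vector_smult_assoc)
qed

lemma hol_one_form_local:
  assumes "\<And>p. p \<in> V \<Longrightarrow> \<exists>N \<eta>. openin X N \<and> p \<in> N \<and> hol_one_form A N \<eta> \<and> forms_agree A N \<eta> \<omega>"
  shows "hol_one_form A V \<omega>"
  unfolding hol_one_form_def
proof (intro conjI ballI allI)
  fix c k assume c: "c \<in> A"
  show "holo_on (\<lambda>z. \<omega> c z $ k) (snd c ` (fst c \<inter> V))"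
    unfolding holo_on_def
  proof
    fix z assume "z \<in> snd c ` (fst c \<inter> V)"
    then obtain x where x: "x \<in> fst c" "x \<in> V" "z = snd c x"
      by blast
    then obtain N \<eta> where N: "openin X N" "x \<in> N" "hol_one_form A N \<eta>" "forms_agree A N \<eta> \<omega>"
      using assms by blast
    have "holo_on (\<lambda>z. \<eta> c z $ k) (snd c ` (fst c \<inter> N))"
      using N(3) c unfolding hol_one_form_def by blast
    then have "holo_on (\<lambda>z. \<omega> c z $ k) (snd c ` (fst c \<inter> N))"
      by (rule holo_on_cong_open[OF _ open_chart_image[OF c N(1)]])
         (use N(4) c in \<open>auto simp: forms_agree_def\<close>)
    then show "\<exists>D. ((\<lambda>z. \<omega> c z $ k) has_derivative D) (at z) \<and> (\<forall>a v. D (a *s v) = a * D v)"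
      using x N(2) unfolding holo_on_def by blast
  qed
next
  fix c d z assume c: "c \<in> A" and d: "d \<in> A" and "z \<in> snd c ` (fst c \<inter> fst d \<inter> V)"
  then obtain x where x: "x \<in> fst c" "x \<in> fst d" "x \<in> V" "z = snd c x"
    by blast
  then obtain N \<eta> where N: "openin X N" "x \<in> N" "hol_one_form A N \<eta>" "forms_agree A N \<eta> \<omega>"
    using assms by blast
  have "\<eta> c z = (\<Sum>l\<in>UNIV. \<eta> d (coord_rep c (snd d) z) $ l *s cgrad (\<lambda>w. coord_rep c (snd d) w $ l) z)"
    using N(2,3) c d x unfolding hol_one_form_def by blast
  moreover have "\<eta> c z = \<omega> c z" "\<eta> d (coord_rep c (snd d) z) = \<omega> d (coord_rep c (snd d) z)"
    using N(2,4) c d x by (auto simp: forms_agree_def coord_rep_chart)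
  ultimately show "\<omega> c z = (\<Sum>l\<in>UNIV. \<omega> d (coord_rep c (snd d) z) $ l *s
      cgrad (\<lambda>w. coord_rep c (snd d) w $ l) z)"
    by simp
qed

text \<open>Agreement on an open neighbourhood transfers the first derivatives of the coefficients
  along with their values.\<close>

lemma closed_one_form_local:
  assumes "\<And>p. p \<in> V \<Longrightarrow> \<exists>N \<eta>. openin X N \<and> p \<in> N \<and> closed_one_form A N \<eta> \<and> forms_agree A N \<eta> \<omega>"
  shows "closed_one_form A V \<omega>"
  unfolding closed_one_form_def
proof (intro ballI allI)
  fix c z j k assume c: "c \<in> A" and "z \<in> snd c ` (fst c \<inter> V)"
  then obtain x where x: "x \<in> fst c" "x \<in> V" "z = snd c x"
    by blast
  then obtain N \<eta> where N: "openin X N" "x \<in> N" "closed_one_form A N \<eta>" "forms_agree A N \<eta> \<omega>"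
    using assms by blast
  have "cgrad (\<lambda>w. \<eta> c w $ k) z = cgrad (\<lambda>w. \<omega> c w $ k) z" for k
    by (rule cgrad_cong_open[OF open_chart_image[OF c N(1)]])
       (use x N(2,4) c in \<open>auto simp: forms_agree_def\<close>)
  moreover have "cgrad (\<lambda>w. \<eta> c w $ k) z $ j = cgrad (\<lambda>w. \<eta> c w $ j) z $ k"
    using N(2,3) c x unfolding closed_one_form_def by blast
  ultimately show "cgrad (\<lambda>w. \<omega> c w $ k) z $ j = cgrad (\<lambda>w. \<omega> c w $ j) z $ k"
    by simp
qed

end


section \<open>Reduced divisors and the logarithmic derivative\<close>

text \<open>The divisibility clause already quantifies over smaller open sets, hence it restricts.
  This gives defining functions on intersections with the domain of a frame.\<close>

lemma local_defining_function_subset: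
  assumes "local_defining_function X A W U f" "openin X V" "V \<subseteq> U"
  shows "local_defining_function X A W V f"
proof -
  have f: "holo_fun A U f" "{x \<in> U. f x = 0} = W \<inter> U" and
    div: "\<forall>q\<in>U. \<forall>N h. openin X N \<and> q \<in> N \<and> N \<subseteq> U \<and> holo_fun A N h \<and> (\<forall>x\<in>W \<inter> N. h x = 0) \<longrightarrow>
        (\<exists>N' k. openin X N' \<and> q \<in> N' \<and> N' \<subseteq> N \<and> holo_fun A N' k \<and> (\<forall>x\<in>N'. h x = k x * f x))"
    using assms(1) unfolding local_defining_function_def by simp_all
  show ?thesis
    unfolding local_defining_function_def
  proof (intro conjI ballI allI impI)
    show "holo_fun A V f"
      using f(1) assms(3) by (rule holo_fun_subset)
    show "{x \<in> V. f x = 0} = W \<inter> V"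
      using f(2) assms(3) by blast
  next
    fix q N h
    assume "q \<in> V"
      and "openin X N \<and> q \<in> N \<and> N \<subseteq> V \<and> holo_fun A N h \<and> (\<forall>x\<in>W \<inter> N. h x = 0)"
    then show "\<exists>N' k. openin X N' \<and> q \<in> N' \<and> N' \<subseteq> N \<and> holo_fun A N' k \<and> (\<forall>x\<in>N'. h x = k x * f x)"
      using assms(3) by (intro div[rule_format]) auto
  qed (rule assms(2))
qed

text \<open>At an interior point the empty family of equations cuts out \<open>W\<close>, so the
  point is regular of codimension zero, which local codimension one forbids.\<close>

lemma reduced_divisor_interior_empty:
  assumes "reduced_divisor X A W"
  shows "X interior_of W = {}"
proof (rule ccontr)
  assume "X interior_of W \<noteq> {}"
  then obtain p where p: "p \<in> X interior_of W"
    by blast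
  have "X interior_of W \<subseteq> regular_points X A W 0"
    unfolding regular_points_def
  proof safe
    fix x assume x: "x \<in> X interior_of W"
    then show "x \<in> W"
      using interior_of_subset by fast
    show "\<exists>U (f :: nat \<Rightarrow> 'a \<Rightarrow> complex). openin X U \<and> x \<in> U \<and> (\<forall>i<0. holo_fun A U (f i)) \<and>
        W \<inter> U = {x\<in>U. \<forall>i<0. f i x = 0} \<and>
        (\<forall>c\<in>A. x \<in> fst c \<longrightarrow>
           (\<forall>a. (\<Sum>i<0. a i *s cgrad (coord_rep c (f i)) (snd c x)) = 0 \<longrightarrow> (\<forall>i<0. a i = 0)))"
      using x interior_of_subset[of X W] by (intro exI[of _ "X interior_of W"]) auto
  qed
  moreover have "X interior_of W \<subseteq> topspace X"
    by (rule interior_of_subset_topspace)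
  ultimately have "p \<in> X closure_of regular_points X A W 0"
    using p by (auto simp: in_closure_of)
  moreover have "p \<in> W"
    using p interior_of_subset by fast
  ultimately show False
    using assms unfolding reduced_divisor_def has_local_codim_def by blast
qed

context complex_manifold
begin

text \<open>Density of the complement of \<open>W\<close>, transported to coordinates: a nonempty
  \<open>T\<close> would pull back to a nonempty open set inside \<open>W\<close>.\<close>

lemma open_chart_subset_empty:
  assumes "X interior_of W = {}" "c \<in> A" "open T" "T \<subseteq> snd c ` (fst c \<inter> W)"
  shows "T = {}"
proof -
  let ?N = "{x \<in> fst c. snd c x \<in> T}"
  have "?N \<subseteq> W"
  proof safe
    fix x assume x: "x \<in> fst c" "snd c x \<in> T"
    then obtain y where "y \<in> fst c" "y \<in> W" "snd c x = snd c y"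
      using assms(4) by blast
    then show "x \<in> W"
      using inv_into_chart[OF assms(2)] x(1) by metis
  qed
  then have "?N = {}"
    using interior_of_maximal[OF _ openin_chart_vimage[OF assms(2,3)]] assms(1) by blast
  then show ?thesis
    using assms(4) by blast
qed

text \<open>If \<open>\<eta>\<close> extends \<open>du / u\<close> across a zero of \<open>u\<close>, then \<open>du = u \<eta>\<close> holds by density also on \<open>W\<close>,
  and this linear equation forces \<open>u\<close> to vanish near that zero.\<close>

lemma dlog_form_no_extension:
  assumes W: "X interior_of W = {}"
    and V: "openin X V" "holo_fun A V u" "{x \<in> V. u x = 0} = W \<inter> V"
    and p: "p \<in> V" "p \<in> U" "p \<in> W"
    and U: "openin X U" "hol_one_form A U \<eta>"
    and agree: "forms_agree A (U \<inter> V - W) \<eta> (dlog_form u)"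
  shows False
proof -
  obtain c where c: "c \<in> A" "p \<in> fst c"
    using ex_chart openin_subset[OF V(1)] p(1) by blast
  define g where "g = coord_rep c u"
  define \<theta> where "\<theta> = \<eta> c"
  have "open (snd c ` (fst c \<inter> (U \<inter> V)))" "snd c p \<in> snd c ` (fst c \<inter> (U \<inter> V))"
    using open_chart_image[OF c(1)] V(1) U(1) c(2) p by blast+
  then obtain r where r: "0 < r" and sub: "ball (snd c p) r \<subseteq> snd c ` (fst c \<inter> (U \<inter> V))"
    using open_contains_ball by blast
  \<comment> \<open>A ball, because the uniqueness argument runs along segments and needs
    convexity.\<close>
  define S where "S = ball (snd c p) r"
  have S: "open S" "convex S" "snd c p \<in> S"
    using r by (simp_all add: S_def)
  have zE: "\<exists>x. x \<in> fst c \<inter> (U \<inter> V) \<and> z = snd c x \<and> g z = u x" if "z \<in> S" for z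
  proof -
    obtain x where "x \<in> fst c \<inter> (U \<inter> V)" "z = snd c x"
      using sub \<open>z \<in> S\<close> unfolding S_def by blast
    then show ?thesis
      using c(1) by (auto simp: g_def coord_rep_chart)
  qed
  have g: "holo_on g S"
    unfolding g_def by (rule holo_on_subset[OF holo_funD[OF V(2) c(1)]]) (use zE in blast)
  have \<theta>: "holo_on (\<lambda>z. \<theta> z $ k) S" for k
    using U(2) c(1) zE unfolding \<theta>_def hol_one_form_def by (blast intro: holo_on_subset)
  have off: "cgrad g z = g z *s \<theta> z" if z: "z \<in> S" "g z \<noteq> 0" for z
  proof -
    obtain x where x: "x \<in> fst c" "x \<in> U \<inter> V" "z = snd c x" "g z = u x"
      using zE[OF z(1)] by blast
    then have "x \<notin> W"
      using z(2) V(3) by auto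
    then have "\<theta> z = dlog_form u c z"
      using agree c(1) x unfolding forms_agree_def \<theta>_def by blast
    then show ?thesis
      using z(2) by (simp add: dlog_form_apply g_def[symmetric] vector_smult_assoc)
  qed
  have ode: "cgrad g z = g z *s \<theta> z" if "z \<in> S" for z
  proof (rule ccontr)
    assume "cgrad g z \<noteq> g z *s \<theta> z"
    then obtain k where k: "cgrad g z $ k - g z * \<theta> z $ k \<noteq> 0"
      by (auto simp: vec_eq_iff)
    \<comment> \<open>One component of the defect in the equation: it is continuous and vanishes off
      \<open>W\<close>, so the set where it is nonzero is open and contained in \<open>W\<close>,
      hence empty.\<close>
    define F where "F z = cgrad g z $ k - g z * \<theta> z $ k" for z
    have "continuous_on S F"
      unfolding F_def by (intro continuous_on_diff continuous_on_mult continuous_on_cgrad[OF S(1) g]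
          holo_on_imp_continuous_on[OF g] holo_on_imp_continuous_on[OF \<theta>])
    then have "open (S \<inter> F -` (- {0}))"
      by (rule continuous_open_preimage[OF _ S(1)]) auto
    moreover have "S \<inter> F -` (- {0}) \<subseteq> snd c ` (fst c \<inter> W)"
    proof
      fix w assume w: "w \<in> S \<inter> F -` (- {0})"
      then have "g w = 0"
        using off[of w] w by (cases "g w = 0") (auto simp: F_def)
      then show "w \<in> snd c ` (fst c \<inter> W)"
        using zE[of w] w V(3) by auto
    qed
    ultimately have "S \<inter> F -` (- {0}) = {}"
      by (rule open_chart_subset_empty[OF W c(1)])
    then show False
      using that k by (auto simp: F_def)
  qed
  have "g (snd c p) = 0"
    using p c V(3) by (auto simp: g_def coord_rep_chart)
  then have "g z = 0" if "z \<in> S" for z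
    using logarithmic_ode_zero[OF S(2) g holo_on_imp_continuous_on[OF \<theta>] ode S(3)] that by blast
  then have "S \<subseteq> snd c ` (fst c \<inter> W)"
    using zE V(3) by fastforce
  then show False
    using open_chart_subset_empty[OF W c(1) S(1)] S(3) by blast
qed

text \<open>For \<open>u = f\<^sup>m e\<close> one has \<open>f du / u = m df + f de / e\<close>, without poles.\<close>

lemma simple_pole_dlog_form:
  assumes "openin X N" "holo_fun A N f" "holo_fun A N e" "\<And>x. x \<in> N \<Longrightarrow> e x \<noteq> 0"
    and "\<And>x. x \<in> N \<Longrightarrow> u x = f x ^ m * e x"
  obtains \<eta> where "hol_one_form A N \<eta>"
    "forms_agree A {x \<in> N. f x \<noteq> 0} \<eta> (scale_form f (dlog_form u))"
proof -
  define \<eta> :: "('a, 'n) one_form" where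
    "\<eta> = (\<lambda>c z. scale_form (\<lambda>_. of_nat m) (d_form f) c z + scale_form f (dlog_form e) c z)"
  have "{x \<in> N. e x \<noteq> 0} = N"
    using assms(4) by blast
  then have "hol_one_form A N (dlog_form e)"
    using hol_one_form_dlog_form[OF assms(1,3)] by simp
  then have "hol_one_form A N \<eta>"
    unfolding \<eta>_def
    by (intro hol_one_form_add hol_one_form_scale assms hol_one_form_d_form holo_fun_const)
  moreover have "forms_agree A {x \<in> N. f x \<noteq> 0} \<eta> (scale_form f (dlog_form u))"
    unfolding forms_agree_def
  proof (intro ballI)
    fix c z assume c: "c \<in> A" and "z \<in> snd c ` (fst c \<inter> {x \<in> N. f x \<noteq> 0})"
    then obtain x where x: "x \<in> fst c" "x \<in> N" "f x \<noteq> 0" "z = snd c x"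
      by blast
    let ?S = "snd c ` (fst c \<inter> N)"
    have S: "open ?S" "z \<in> ?S"
      using open_chart_image[OF c assms(1)] x by auto
    let ?f = "coord_rep c f" and ?e = "coord_rep c e"
    have nz: "?f z \<noteq> 0" "?e z \<noteq> 0" and uz: "coord_rep c u z = ?f z ^ m * ?e z"
      using x c assms(4,5) by (simp_all add: coord_rep_chart)
    have "has_cgrad (\<lambda>w. ?f w ^ m * ?e w) (?f z ^ m *s cgrad ?e z
        + ?e z *s ((of_nat m * ?f z ^ (m - 1)) *s cgrad ?f z)) z"
      by (intro has_cgrad_mult has_cgrad_power holo_on_imp_has_cgrad[OF holo_funD[OF assms(2) c] S(2)]
          holo_on_imp_has_cgrad[OF holo_funD[OF assms(3) c] S(2)])
    then have "has_cgrad (coord_rep c u) (?f z ^ m *s cgrad ?e z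
        + ?e z *s ((of_nat m * ?f z ^ (m - 1)) *s cgrad ?f z)) z"
      by (rule has_cgrad_transform_open[OF _ S]) (use c assms(5) in \<open>auto simp: coord_rep_chart\<close>)
    then have cg: "cgrad (coord_rep c u) z = ?f z ^ m *s cgrad ?e z
        + ?e z *s ((of_nat m * ?f z ^ (m - 1)) *s cgrad ?f z)"
      by (rule has_cgrad_imp_cgrad)
    \<comment> \<open>Truncation in \<open>m - 1\<close> does no harm at \<open>m = 0\<close>, where
      the factor \<open>of_nat m\<close> is zero.\<close>
    have "of_nat m * ?f z ^ (m - 1) * ?f z = of_nat m * ?f z ^ m"
      by (cases m) (auto simp: mult_ac)
    then have "of_nat m * (?f z * ?f z ^ (m - 1)) = of_nat m * ?f z ^ m"
      by (simp add: mult_ac)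
    then show "\<eta> c z = scale_form f (dlog_form u) c z"
      using nz
      by (auto simp: \<eta>_def scale_form_def dlog_form_apply d_form_def cg uz vec_eq_iff coord_rep_apply[of c "\<lambda>_. of_nat m"]
          field_simps)
  qed
  ultimately show ?thesis
    using that by blast
qed

text \<open>Bundles are eliminated here: what remains of a flat trivialization is a family
  \<open>F\<close> of local equations of \<open>mW\<close> with constant ratios.
  \<open>F_power\<close> relates a member near each point to a reduced equation \<open>f\<close> and
  a nowhere zero factor \<open>e\<close>, which bounds the pole order by one.\<close>

lemma ex_form_of_local_equations:
  assumes W: "X interior_of W = {}" and W_subset: "W \<subseteq> topspace X"
    and F: "\<And>V u. (V, u) \<in> F \<Longrightarrow>
      openin X V \<and> holo_fun A V u \<and> {x \<in> V. u x = 0} = W \<inter> V"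
    and F_const: "\<And>V u V' u'. (V, u) \<in> F \<Longrightarrow> (V', u') \<in> F \<Longrightarrow> \<exists>k. \<forall>x\<in>V \<inter> V'. u' x = k * u x"
    and F_power: "\<And>p. p \<in> topspace X \<Longrightarrow> \<exists>V u N f e. (V, u) \<in> F \<and> p \<in> N \<and> N \<subseteq> V \<and>
      local_defining_function X A W N f \<and> holo_fun A N e \<and>
      (\<forall>x\<in>N. e x \<noteq> 0 \<and> u x = f x ^ m * e x)"
  shows "\<exists>\<omega> :: ('a, 'n) one_form.
           meromorphic_one_form X A \<omega> \<and>
           hol_one_form A (topspace X - W) \<omega> \<and>
           closed_one_form A (topspace X - W) \<omega> \<and>
           simple_poles_along X A W \<omega>"
proof -
  \<comment> \<open>A point may lie in several domains of \<open>F\<close>. An arbitrary member is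
    chosen point by point; constant ratios make the result independent of the choice off
    \<open>W\<close>.\<close>
  define \<omega> :: "('a, 'n) one_form" where
    "\<omega> = (\<lambda>c z. dlog_form (snd (SOME P. P \<in> F \<and> inv_into (fst c) (snd c) z \<in> fst P)) c z)"
  have F_nz: "V - W = {x \<in> V. u x \<noteq> 0}" if "(V, u) \<in> F" for V u
    using F[OF that] by blast
  have F_openin: "openin X (V - W)" if "(V, u) \<in> F" for V u
    unfolding F_nz[OF that] using F[OF that] by (intro openin_nonzero) auto
  have \<omega>: "forms_agree A (V - W) (dlog_form u) \<omega>" if Vu: "(V, u) \<in> F" for V u
    unfolding forms_agree_def
  proof (intro ballI)
    fix c z assume c: "c \<in> A" and "z \<in> snd c ` (fst c \<inter> (V - W))"
    then obtain x where x: "x \<in> fst c" "x \<in> V" "x \<notin> W" "z = snd c x"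
      by blast
    define P where "P = (SOME P. P \<in> F \<and> x \<in> fst P)"
    have P: "P \<in> F \<and> x \<in> fst P"
      unfolding P_def by (rule someI[of _ "(V, u)"]) (use Vu x in simp)
    obtain V' u' where P_eq: "P = (V', u')"
      by fastforce
    then have V'u': "(V', u') \<in> F" "x \<in> V'"
      using P by auto
    obtain k where k: "\<And>x. x \<in> V \<inter> V' \<Longrightarrow> u' x = k * u x"
      using F_const[OF Vu V'u'(1)] by blast
    \<comment> \<open>\<open>F_const\<close> alone allows \<open>k = 0\<close>; off \<open>W\<close>
      neither local equation vanishes, which rules this out.\<close>
    have "u' x \<noteq> 0"
      using F[OF V'u'(1)] V'u'(2) x(3) by auto
    then have "k \<noteq> 0"
      using k x(2) V'u'(2) by auto
    have "forms_agree A (V \<inter> V') (dlog_form u') (dlog_form u)"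
      using F[OF Vu] F[OF V'u'(1)]
      by (intro dlog_form_cmult[OF _ _ k \<open>k \<noteq> 0\<close>]) (auto intro: holo_fun_subset)
    then have "dlog_form u' c z = dlog_form u c z"
      using c x V'u'(2) unfolding forms_agree_def by blast
    moreover have "\<omega> c z = dlog_form u' c z"
      using c x P_eq by (simp add: \<omega>_def inv_into_chart P_def)
    ultimately show "dlog_form u c z = \<omega> c z"
      by simp
  qed
  have cover: "\<exists>V u. (V, u) \<in> F \<and> p \<in> V" if "p \<in> topspace X" for p
    using F_power[OF that] by blast
  \<comment> \<open>Stated at all points of \<open>X\<close>, so that it yields both meromorphy with
    denominator \<open>f\<close> and the bound on the pole order along \<open>W\<close>.\<close>
  have pole: "\<exists>V u N f \<eta>. (V, u) \<in> F \<and> p \<in> N \<and> p \<in> V \<and> local_defining_function X A W N f \<and>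
      hol_one_form A N \<eta> \<and> forms_agree A (N - W) \<eta> (scale_form f \<omega>)"
    if p: "p \<in> topspace X" for p
  proof -
    obtain V u N f e where N: "(V, u) \<in> F" "p \<in> N" "N \<subseteq> V" "local_defining_function X A W N f"
        "holo_fun A N e" "\<And>x. x \<in> N \<Longrightarrow> e x \<noteq> 0" "\<And>x. x \<in> N \<Longrightarrow> u x = f x ^ m * e x"
      using F_power[OF p] by blast
    then have f: "openin X N" "holo_fun A N f" "{x \<in> N. f x = 0} = W \<inter> N"
      unfolding local_defining_function_def by auto
    obtain \<eta> where \<eta>: "hol_one_form A N \<eta>"
        "forms_agree A {x \<in> N. f x \<noteq> 0} \<eta> (scale_form f (dlog_form u))"
      using simple_pole_dlog_form[OF f(1,2) N(5-7)] by blast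
    have "{x \<in> N. f x \<noteq> 0} = N - W"
      using f(3) by blast
    moreover have "forms_agree A (N - W) (scale_form f (dlog_form u)) (scale_form f \<omega>)"
      by (rule forms_agree_scale[OF forms_agree_subset[OF \<omega>[OF N(1)]]]) (use N(3) in blast)
    ultimately have "forms_agree A (N - W) \<eta> (scale_form f \<omega>)"
      using \<eta>(2) forms_agree_trans by metis
    then show ?thesis
      using N(1-4) \<eta>(1) by blast
  qed
  have "meromorphic_one_form X A \<omega>"
    unfolding meromorphic_one_form_def
  proof
    fix p assume "p \<in> topspace X"
    then obtain N f \<eta> where N: "p \<in> N" "local_defining_function X A W N f"
        "hol_one_form A N \<eta>" "forms_agree A (N - W) \<eta> (scale_form f \<omega>)"
      using pole by blast
    then have f: "openin X N" "holo_fun A N f" "{x \<in> N. f x = 0} = W \<inter> N"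
      unfolding local_defining_function_def by auto
    have "X interior_of (W \<inter> N) = {}"
      using W by (simp add: interior_of_Int)
    then show "\<exists>U g \<eta>. openin X U \<and> p \<in> U \<and> holo_fun A U g \<and> X interior_of {x\<in>U. g x = 0} = {} \<and>
        hol_one_form A U \<eta> \<and> forms_agree A (U - {x\<in>U. g x = 0}) \<eta> (scale_form g \<omega>)"
      using f N by (intro exI[of _ N] exI[of _ f] exI[of _ \<eta>]) (simp add: Diff_Int)
  qed
  moreover have "hol_one_form A (topspace X - W) \<omega>"
  proof (rule hol_one_form_local)
    fix p assume p: "p \<in> topspace X - W"
    then obtain V u where Vu: "(V, u) \<in> F" "p \<in> V"
      using cover by blast
    have "hol_one_form A (V - W) (dlog_form u)"
      unfolding F_nz[OF Vu(1)] using F[OF Vu(1)] by (intro hol_one_form_dlog_form) auto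
    then show "\<exists>N \<eta>. openin X N \<and> p \<in> N \<and> hol_one_form A N \<eta> \<and> forms_agree A N \<eta> \<omega>"
      using F_openin \<omega> Vu p by blast
  qed
  moreover have "closed_one_form A (topspace X - W) \<omega>"
  proof (rule closed_one_form_local)
    fix p assume p: "p \<in> topspace X - W"
    then obtain V u where Vu: "(V, u) \<in> F" "p \<in> V"
      using cover by blast
    have "closed_one_form A (V - W) (dlog_form u)"
      unfolding F_nz[OF Vu(1)] using F[OF Vu(1)] by (intro closed_dlog_form) auto
    then show "\<exists>N \<eta>. openin X N \<and> p \<in> N \<and> closed_one_form A N \<eta> \<and> forms_agree A N \<eta> \<omega>"
      using F_openin \<omega> Vu p by blast
  qed
  moreover have "simple_poles_along X A W \<omega>"
    unfolding simple_poles_along_def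
  proof (intro ballI conjI notI)
    fix p assume p: "p \<in> W"
    then obtain N f \<eta> where "p \<in> N" "local_defining_function X A W N f"
        "hol_one_form A N \<eta>" "forms_agree A (N - W) \<eta> (scale_form f \<omega>)"
      using pole[of p] W_subset by blast
    then show "\<exists>U f \<eta>. p \<in> U \<and> local_defining_function X A W U f \<and>
        hol_one_form A U \<eta> \<and> forms_agree A (U - W) \<eta> (scale_form f \<omega>)"
      by blast
  next
    fix p assume p: "p \<in> W"
      and "\<exists>U \<eta>. openin X U \<and> p \<in> U \<and> hol_one_form A U \<eta> \<and> forms_agree A (U - W) \<eta> \<omega>"
    then obtain U \<eta> where U: "openin X U" "p \<in> U" "hol_one_form A U \<eta>" "forms_agree A (U - W) \<eta> \<omega>"
      by blast
    obtain V u where Vu: "(V, u) \<in> F" "p \<in> V"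
      using cover p W_subset by blast
    have "forms_agree A (U \<inter> V - W) \<eta> \<omega>"
      by (rule forms_agree_subset[OF U(4)]) blast
    moreover have "forms_agree A (U \<inter> V - W) \<omega> (dlog_form u)"
      by (rule forms_agree_subset[OF forms_agree_sym[OF \<omega>[OF Vu(1)]]]) blast
    ultimately have "forms_agree A (U \<inter> V - W) \<eta> (dlog_form u)"
      by (rule forms_agree_trans)
    then show False
      using F[OF Vu(1)] by (intro dlog_form_no_extension[OF W _ _ _ Vu(2) U(2) p U(1,3)]) auto
  qed
  ultimately show ?thesis
    by blast
qed

end

section \<open>Local equations of \<open>mW\<close> from a flat trivialization\<close>

theorem corollary1p7:
  fixes X :: "'a topology" and A :: "('a, 'n::finite) chart set" and W :: "'a set"
  assumes "compact_complex_manifold X A"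
    and "reduced_divisor X A W"
    and "\<exists>m::nat. m > 0 \<and> flat_multiple X A m W"
  shows "\<exists>\<omega> :: ('a, 'n) one_form.
           meromorphic_one_form X A \<omega> \<and>
           hol_one_form A (topspace X - W) \<omega> \<and>
           closed_one_form A (topspace X - W) \<omega> \<and>
           simple_poles_along X A W \<omega>"
proof -
  interpret complex_manifold X A
    by unfold_locales (rule assms(1))
  obtain m I g where m: "m > 0" and mW: "divisor_bundle X A m W I g"
      and flat: "flat_line_bundle X A I fst g"
    using assms(3) unfolding flat_multiple_def by blast
  have ldf: "local_defining_function X A W (fst i) (snd i)" if "i \<in> I" for i
    using mW that unfolding divisor_bundle_def by (auto simp: case_prod_beta)
  have I_open: "openin X (fst i)" if "i \<in> I" for i
    using ldf[OF that] unfolding local_defining_function_def by blast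
  have I_cover: "\<exists>i\<in>I. x \<in> fst i" if "x \<in> topspace X" for x
    using mW that unfolding divisor_bundle_def line_bundle_def by blast
  have g: "g i j x \<noteq> 0" "snd i x ^ m = g i j x * snd j x ^ m"
    if "i \<in> I" "j \<in> I" "x \<in> fst i \<inter> fst j" for i j x
    using mW that unfolding divisor_bundle_def line_bundle_def by blast+
  obtain T where T_frame: "\<forall>(V, s)\<in>T. local_frame X A I fst g V s"
    and T_cover: "\<Union> (fst ` T) = topspace X"
    and T_const: "\<forall>(V, s)\<in>T. \<forall>(V', s')\<in>T. \<exists>c. \<forall>i\<in>I. \<forall>x\<in>V \<inter> V' \<inter> fst i. s i x = c * s' i x"
    using flat unfolding flat_line_bundle_def by blast
  have s: "openin X V" "i \<in> I \<Longrightarrow> holo_fun A (V \<inter> fst i) (s i)"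
    "i \<in> I \<Longrightarrow> x \<in> V \<inter> fst i \<Longrightarrow> s i x \<noteq> 0"
    "i \<in> I \<Longrightarrow> j \<in> I \<Longrightarrow> x \<in> V \<inter> fst i \<inter> fst j \<Longrightarrow> s i x = g i j x * s j x"
    if "(V, s) \<in> T" for V s i j x
    using T_frame that unfolding local_frame_def by blast+
  \<comment> \<open>A frame is a family indexed by \<open>I\<close>; choosing an index at each point
    turns its quotients into one function on the whole domain of the frame.\<close>
  define ind where "ind x = (SOME i. i \<in> I \<and> x \<in> fst i)" for x
  define quot where "quot s x = snd (ind x) x ^ m / s (ind x) x"
    for s :: "'a set \<times> ('a \<Rightarrow> complex) \<Rightarrow> 'a \<Rightarrow> complex" and x
  \<comment> \<open>The \<open>m\<close>-th power of the defining function and the frame component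
    pick up the same factor \<open>g i j\<close> under a change of index, so their quotient does not
    depend on the index.\<close>
  have quot: "quot s x = snd i x ^ m * inverse (s i x)"
    if Vs: "(V, s) \<in> T" and i: "i \<in> I" and x: "x \<in> V" "x \<in> fst i" for V s i x
  proof -
    have j: "ind x \<in> I \<and> x \<in> fst (ind x)"
      unfolding ind_def by (rule someI) (use i x in blast)
    have "snd (ind x) x ^ m = g (ind x) i x * snd i x ^ m" "s (ind x) x = g (ind x) i x * s i x"
      "g (ind x) i x \<noteq> 0"
      using g[of "ind x" i x] s(4)[OF Vs, of "ind x" i x] i j x by blast+
    then show ?thesis
      by (simp add: quot_def divide_inverse)
  qed
  have quot_holo: "holo_fun A (V \<inter> fst i) (quot s)" if Vs: "(V, s) \<in> T" and i: "i \<in> I" for V s i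
  proof (rule holo_fun_cong)
    show "holo_fun A (V \<inter> fst i) (\<lambda>x. snd i x ^ m * inverse (s i x))"
    proof (intro holo_fun_mult holo_fun_power)
      have "holo_fun A (fst i) (snd i)"
        using ldf[OF i] unfolding local_defining_function_def by blast
      then show "holo_fun A (V \<inter> fst i) (snd i)"
        by (rule holo_fun_subset) blast
      show "holo_fun A (V \<inter> fst i) (\<lambda>x. inverse (s i x))"
        by (rule holo_fun_inverse[OF s(2,3)[OF Vs i]])
    qed
    show "openin X (V \<inter> fst i)"
      using s(1)[OF Vs] I_open[OF i] by blast
  qed (use quot[OF Vs i] in auto)
  let ?F = "{(V, quot s) |V s. (V, s) \<in> T}"
  show ?thesis
  proof (rule ex_form_of_local_equations[of W ?F m])
    show "X interior_of W = {}"
      by (rule reduced_divisor_interior_empty[OF assms(2)])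
    show "W \<subseteq> topspace X"
      using assms(2) unfolding reduced_divisor_def analytic_subset_def by blast
  next
    fix V u assume "(V, u) \<in> ?F"
    then obtain s where Vs: "(V, s) \<in> T" and u: "u = quot s"
      by blast
    have V_cover: "\<exists>i\<in>I. x \<in> fst i" if "x \<in> V" for x
      using I_cover openin_subset[OF s(1)[OF Vs]] that by blast
    have "holo_fun A V u"
      unfolding u using V_cover quot_holo[OF Vs] by (intro holo_fun_local) blast
    moreover have "u x = 0 \<longleftrightarrow> x \<in> W" if "x \<in> V" for x
    proof -
      obtain i where i: "i \<in> I" "x \<in> fst i"
        using V_cover \<open>x \<in> V\<close> by blast
      \<comment> \<open>Here \<open>m > 0\<close> is essential: only then does the power vanish
        where the defining function does.\<close>
      have "u x = 0 \<longleftrightarrow> snd i x = 0"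
        using quot[OF Vs i(1) \<open>x \<in> V\<close> i(2)] s(3)[OF Vs i(1)] i(2) \<open>x \<in> V\<close> m by (simp add: u)
      also have "\<dots> \<longleftrightarrow> x \<in> W"
        using ldf[OF i(1)] i(2) unfolding local_defining_function_def by blast
      finally show ?thesis .
    qed
    ultimately show "openin X V \<and> holo_fun A V u \<and> {x \<in> V. u x = 0} = W \<inter> V"
      using s(1)[OF Vs] by blast
  next
    fix V u V' u' assume "(V, u) \<in> ?F" "(V', u') \<in> ?F"
    then obtain s s' where Vs: "(V, s) \<in> T" "u = quot s" "(V', s') \<in> T" "u' = quot s'"
      by blast
    then obtain k where k: "\<And>i x. i \<in> I \<Longrightarrow> x \<in> V \<inter> V' \<inter> fst i \<Longrightarrow> s i x = k * s' i x"
      using T_const by fast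
    have "u' x = k * u x" if x: "x \<in> V \<inter> V'" for x
    proof -
      obtain i where i: "i \<in> I" "x \<in> fst i"
        using I_cover openin_subset[OF s(1)[OF Vs(1)]] x by blast
      \<comment> \<open>The frame stands in the denominator, so the constant in
        \<open>s = k s'\<close> reappears in \<open>u' = k u\<close>; nonvanishing of
        \<open>s\<close> gives \<open>k \<noteq> 0\<close>.\<close>
      have "s i x = k * s' i x" "s i x \<noteq> 0"
        using k[OF i(1)] s(3)[OF Vs(1) i(1)] i(2) x by blast+
      then show ?thesis
        using quot[OF Vs(1) i(1) _ i(2)] quot[OF Vs(3) i(1) _ i(2)] x by (simp add: Vs(2,4))
    qed
    then show "\<exists>k. \<forall>x\<in>V \<inter> V'. u' x = k * u x"
      by blast
  next
    fix p assume p: "p \<in> topspace X"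
    then obtain V s i where Vs: "(V, s) \<in> T" "p \<in> V" and i: "i \<in> I" "p \<in> fst i"
      using T_cover I_cover by fastforce
    \<comment> \<open>On this overlap \<open>snd i\<close> serves as \<open>f\<close>, and
      \<open>e\<close> is the reciprocal of the frame component, which has no zeros.\<close>
    have N: "openin X (V \<inter> fst i)"
      using s(1)[OF Vs(1)] I_open[OF i(1)] by blast
    have "local_defining_function X A W (V \<inter> fst i) (snd i)"
      by (rule local_defining_function_subset[OF ldf[OF i(1)] N]) blast
    moreover have "holo_fun A (V \<inter> fst i) (\<lambda>x. inverse (s i x))"
      by (rule holo_fun_inverse[OF s(2,3)[OF Vs(1) i(1)]])
    moreover have "\<forall>x\<in>V \<inter> fst i. inverse (s i x) \<noteq> 0 \<and> quot s x = snd i x ^ m * inverse (s i x)"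
      using s(3)[OF Vs(1) i(1)] quot[OF Vs(1) i(1)] by simp
    moreover have "(V, quot s) \<in> ?F" "p \<in> V \<inter> fst i" "V \<inter> fst i \<subseteq> V"
      using Vs i by auto
    ultimately show "\<exists>V u N f e. (V, u) \<in> ?F \<and> p \<in> N \<and> N \<subseteq> V \<and>
        local_defining_function X A W N f \<and> holo_fun A N e \<and>
        (\<forall>x\<in>N. e x \<noteq> 0 \<and> u x = f x ^ m * e x)"
      by (intro exI conjI)
  qed
qed

end
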